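(* Let $n>1$ be an odd integer and let $r\geqslant 1$. Then, modulo $[n^r]\prod_{j=1}^r\Phi_{n^j}(q)^2$, \begin{align*} \sum_{k=0}^{(n^r-1)/2} q^{k^2}[6k+1]\frac{(q;q^2)_k^2 (q^2;q^4)_k }{(q^4;q^4)_k^3} &\equiv (-q)^{(1-n)/2}[n]\sum_{k=0}^{(n^{r-1}-1)/2} q^{nk^2}[6k+1]_{q^n}\frac{(q^n;q^{2n})_k^2 (q^{2n};q^{4n})_k }{(q^{4n};q^{4n})_k^3},\\ \sum_{k=0}^{n^r-1} q^{k^2}[6k+1]\frac{(q;q^2)_k^2 (q^2;q^4)_k }{(q^4;q^4)_k^3} &\equiv (-q)^{(1-n)/2}[n]\sum_{k=0}^{n^{r-1}-1} q^{nk^2}[6k+1]_{q^n}\frac{(q^n;q^{2n})_k^2 (q^{2n};q^{4n})_k }{(q^{4n};q^{4n})_k^3}. \end{align*}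
   Context: Notation: $(a;q)_k=(1-a)(1-aq)\cdots(1-aq^{k-1})$ (with $(a;q)_0=1$) is the $q$-shifted factorial; $[m]=[m]_q=1+q+\cdots+q^{m-1}$ is the $q$-integer, and $[m]_{q^n}=1+q^n+\cdots+q^{n(m-1)}$. $\Phi_m(q)$ denotes the $m$-th cyclotomic polynomial in $q$. For rational functions $A(q),B(q)$ and a polynomial $P(q)$, $A\equiv B\pmod{P}$ means that $A-B$ can be written as a quotient of polynomials whose numerator is divisible by $P(q)$ and whose denominator is relatively prime to $P(q)$. *)

theory Defs
  imports Complex_Main "HOL-Computational_Algebra.Polynomial_Factorial"
begin

type_synonym ratfun = "complex poly fract"

definition qX :: ratfun where
  "qX = to_fract [:0, 1:]"

definition qpoch :: "ratfun \<Rightarrow> ratfun \<Rightarrow> nat \<Rightarrow> ratfun" where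
  "qpoch a b k = (\<Prod>j<k. 1 - a * b ^ j)"

definition qint :: "ratfun \<Rightarrow> nat \<Rightarrow> ratfun" where
  "qint Q m = (\<Sum>i<m. Q ^ i)"

definition qint_poly :: "nat \<Rightarrow> complex poly" where
  "qint_poly m = (\<Sum>i<m. monom 1 i)"

definition cyclotomic :: "nat \<Rightarrow> complex poly" where
  "cyclotomic m = (\<Prod>k\<in>{k. 1 \<le> k \<and> k \<le> m \<and> coprime k m}.
                     [:- cis (2 * pi * real k / real m), 1:])"

definition qcong :: "ratfun \<Rightarrow> ratfun \<Rightarrow> complex poly \<Rightarrow> bool" where
  "qcong A B P \<longleftrightarrow> (\<exists>N D. D \<noteq> 0 \<and> P dvd N \<and> coprime D P \<and>
                          A - B = to_fract N / to_fract D)"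

definition summand :: "ratfun \<Rightarrow> nat \<Rightarrow> ratfun" where
  "summand Q k = Q ^ (k^2) * qint Q (6*k+1) * qpoch Q (Q^2) k ^ 2 * qpoch (Q^2) (Q^4) k
                 / qpoch (Q^4) (Q^4) k ^ 3"

end

theory Submission
  imports Defs "HOL-Computational_Algebra.Fundamental_Theorem_Algebra"
    "HOL-Computational_Algebra.Field_as_Ring"
begin

text \<open>
  Creative microscoping. Insert a parameter \<open>a\<close> by replacing \<open>(q;q\<^sup>2)\<^sub>k\<^sup>2\<close> with
  \<open>(aq;q\<^sup>2)\<^sub>k (q/a;q\<^sup>2)\<^sub>k\<close> and two of the factors \<open>(q\<^sup>4;q\<^sup>4)\<^sub>k\<close> with
  \<open>(aq\<^sup>4;q\<^sup>4)\<^sub>k (q\<^sup>4/a;q\<^sup>4)\<^sub>k\<close>; everything depends only on \<open>y = a + 1/a - 2\<close>, and \<open>y = 0\<close> is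
  the original sum. At \<open>a = q^e\<close>, \<open>e\<close> odd, the series terminates and has a closed form, so both
  sides agree for every \<open>e = (2j+1)n\<close> within the range of summation. On the other hand, at a root
  of unity \<open>\<zeta>\<close> of odd order \<open>m > 1\<close> both sides vanish for every \<open>y\<close>: the terms are periodic up to
  a factor in blocks of length \<open>m\<close>, and a block sum is the value at \<open>\<zeta>\<close> of a second summable series.
  The difference, cleared of denominators, is therefore a polynomial in \<open>y\<close> over the local ring of
  \<open>\<zeta>\<close>, divisible by \<open>q - \<zeta>\<close> and by all \<open>y - (1-q^e)\<^sup>2/q^e\<close>. At \<open>y = 0\<close> and for \<open>\<zeta>\<close> of order
  \<open>n^i\<close> each factor with \<open>e\<close> divisible by \<open>m\<close> contributes two zeros, two more zeros in total than the
  denominators cancel, which gives order three.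
\<close>

section \<open>Two summable series\<close>

lemma telescoped_sum:
  fixes f G :: "nat \<Rightarrow> 'a::ab_group_add"
  assumes "\<And>k. k < K \<Longrightarrow> f k = G (Suc k) - G k" and "G 0 = 0"
  shows "(\<Sum>k<K. f k) = G K"
  using assms by (induction K) auto

text \<open>The hypothesis says that \<open>f k / g k\<close> equals \<open>h (Suc k) / h k\<close>,
  so the quotient of the two products telescopes. It rewrites products at \<open>z q^4\<close>
  through those at \<open>z\<close>, with \<open>h\<close> collecting the few boundary factors; the
  form without division spares nonvanishing conditions.\<close>

lemma prod_shift:
  fixes f g h :: "nat \<Rightarrow> 'a::comm_monoid_mult"
  assumes "\<And>k. f k * h k = g k * h (Suc k)"
  shows "(\<Prod>j<K. f j) * h 0 = (\<Prod>j<K. g j) * h K"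
proof (induction K)
  case (Suc K)
  have "(\<Prod>j<Suc K. f j) * h 0 = ((\<Prod>j<K. f j) * h 0) * f K" by (simp add: mult_ac)
  also have "\<dots> = (\<Prod>j<K. g j) * (f K * h K)" by (simp only: Suc.IH) (simp add: mult_ac)
  finally show ?case by (simp add: assms mult_ac)
qed simp

text \<open>Up to the factor \<open>1 - q\<close>, the parametric summand at \<open>a = z = q^e\<close>, written without negative powers.\<close>

definition special_term :: "'a::field \<Rightarrow> 'a \<Rightarrow> nat \<Rightarrow> 'a" where
  "special_term q z k = (1 - q^(6*k+1)) * q^(k^2) * (\<Prod>j<k. (1-q^(4*j+2)) * ((1-z*q^(2*j+1)) * (z-q^(2*j+1)))
       / ((1-q^(4*j+4)) * ((1-z*q^(4*j+4)) * (z-q^(4*j+4)))))"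

text \<open>The polynomial identity behind the WZ certificate for the shift \<open>z \<mapsto> z q\<^sup>4\<close>, with \<open>x = q^k\<close>.\<close>

lemma certificate_special_term:
  fixes q x z :: "'a::field"
  shows "(1-q*x^6)*(q^2*(1-z*q*x^2)*(1-z*q^3*x^2)*(z-x^4)+(z*q^3-x^2)*(z*q-x^2)*(1-z*q^4*x^4))
    = -(1+z*q^2)*(x^2*(1-q*x^2)*(1-q^2*x^4)*(1-z*q*x^2)*(z*q^3-x^2)-q*(q-x^2)*(1-x^4)*(1-z*q^4*x^4)*(z-x^4))"
  by (simp add: power2_eq_square power3_eq_cube eval_nat_numeral algebra_simps)

text \<open>The WZ equation after division by the common factor \<open>W\<close> of
  \<open>special_term_shift\<close>, so that only rational functions of \<open>x = q^k\<close>
  remain. Over the common denominator \<open>P\<close> it becomes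
  \<open>certificate_special_term\<close>.\<close>

lemma special_term_step_aux:
  fixes q x z :: "'a::field"
  assumes "q \<noteq> 0" "x \<noteq> 0" "z \<noteq> 1" "1 - z*q \<noteq> 0" "1 - z*q^3 \<noteq> 0" "1 - z*q^4*x^4 \<noteq> 0" "z - x^4 \<noteq> 0"
    "1 - q^4*x^4 \<noteq> 0" "1 - z*q^4 \<noteq> 0"
  shows "(1 - q*x^6) * ((1-z*q*x^2)*(1-z*q^3*x^2)*(1-z*q^4)) / ((1-z*q)*(1-z*q^3)*(1-z*q^4*x^4))
     - (1-z*q^4)/((1-z)*q^2) * ((1 - q*x^6) * ((z*q^4-q*x^2)*(z*q^4-q^3*x^2)*(z-1)) / (q^4*(1-z*q)*(1-z*q^3)*(z-x^4)))
     = -((1-z*q^4)*(1+z*q^2)/(q*(1-z*q)*(1-z*q^3))) * ((q-q^2*x^2)*(1-q^4*x^4)/q^4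
          * (q*x^2*(1-q^2*x^4)*(1-z*q*x^2)*(z*q^4-q*x^2)/((1-q^4*x^4)*(1-z*q^4*x^4)*(z-x^4))) - (q-x^2)*(1-x^4))"
    (is "?L = ?R")
proof -
  define P where "P = (1-z*q)*(1-z*q^3)*(1-z*q^4*x^4)*(z-x^4)*q^2"
  have P: "P \<noteq> 0" using assms by (simp add: P_def)
  have r: "(1-z*q^4)/((1-z)*q^2) * (w * (v*(z-1)) / (q^4*(1-z*q)*(1-z*q^3)*(z-x^4)))
     = - ((1-z*q^4) * w * v / (q^2*q^4*(1-z*q)*(1-z*q^3)*(z-x^4)))" for w v
    using assms by (simp add: divide_simps) (simp add: algebra_simps)
  have "?L = (1-z*q^4) * (1-q*x^6) * (q^2*(1-z*q*x^2)*(1-z*q^3*x^2)*(z-x^4)+(z*q^3-x^2)*(z*q-x^2)*(1-z*q^4*x^4)) / P"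
  proof -
    have f: "(z*q^4-q*x^2)*(z*q^4-q^3*x^2) = q^4 * ((z*q^3-x^2)*(z*q-x^2))" by algebra
    have gen: "w*(a*b*t)/(A*B*C) - (- (t*w*(q^4*m)/(q^2*q^4*A*B*D))) = t*w*(q^2*a*b*D+m*C)/(A*B*C*D*q^2)"
      if "A \<noteq> 0" "B \<noteq> 0" "C \<noteq> 0" "D \<noteq> 0" for w a b t A B C D m
      using that assms(1) by (simp add: divide_simps) (simp add: algebra_simps)
    show ?thesis unfolding r f P_def by (rule gen) (use assms in auto)
  qed
  also have "\<dots> = (1-z*q^4) * (-(1+z*q^2)*(x^2*(1-q*x^2)*(1-q^2*x^4)*(1-z*q*x^2)*(z*q^3-x^2)-q*(q-x^2)*(1-x^4)*(1-z*q^4*x^4)*(z-x^4))) / P"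
    by (simp only: certificate_special_term mult.assoc[of "1-z*q^4" "1-q*x^6"])
  also have "\<dots> = ?R"
  proof -
    have e: "(q-q^2*x^2)*(1-q^4*x^4)/q^4 * (q*x^2*(1-q^2*x^4)*(1-z*q*x^2)*(z*q^4-q*x^2)/((1-q^4*x^4)*(1-z*q^4*x^4)*(z-x^4)))
        = x^2*(1-q*x^2)*(1-q^2*x^4)*(1-z*q*x^2)*(z*q^3-x^2)/ (q*(1-z*q^4*x^4)*(z-x^4))"
    proof -
      have f: "z*q^4-q*x^2 = q*(z*q^3-x^2)" "q-q^2*x^2 = q*(1-q*x^2)" by algebra+
      have g: "q ^ 4 = q*q*q*q" by algebra
      show ?thesis unfolding f using assms by (simp add: divide_simps) (simp add: g mult.assoc)
    qed
    have gen: "t*(-u*(S - q*a*b*C*D))/(A*B*C*D*q^2) = -(t*u/(q*A*B)) * (S/(q*C*D) - a*b)"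
      if "A \<noteq> 0" "B \<noteq> 0" "C \<noteq> 0" "D \<noteq> 0" for t u S a b A B C D
      using that assms(1) by (simp add: divide_simps) (simp add: algebra_simps power2_eq_square)
    show ?thesis unfolding P_def e by (rule gen) (use assms in auto)
  qed
  finally show ?thesis .
qed

text \<open>The terms at \<open>z q^4\<close> and at \<open>z\<close> are rational multiples of one
  product \<open>W\<close>. The product keeps the factors \<open>z q^4 - q^(2j+1)\<close>, so that
  it becomes zero once the series at \<open>z q^4\<close> has terminated.\<close>

lemma special_term_shift:
  fixes q z :: "'a::field" and K :: nat
  assumes q: "q \<noteq> 0" and nz: "\<And>j. 1 - z*q^j \<noteq> 0" "\<And>j. z - q^(4*j) \<noteq> 0"
      "\<And>j. 1 - q^(4*j+4) \<noteq> 0"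
  defines "x \<equiv> q^K"
  defines "W \<equiv> q^(K^2) * (\<Prod>j<K. (1-q^(4*j+2)) / (1-q^(4*j+4)) * (1-z*q^(2*j+1)) * (z*q^4-q^(2*j+1))
                    / ((1-z*q^(4*j+4)) * (z-q^(4*j)))) / x^4"
  shows "special_term q (z*q^4) K = (1 - q*x^6) * ((1-z*q*x^2)*(1-z*q^3*x^2)*(1-z*q^4)) / ((1-z*q)*(1-z*q^3)*(1-z*q^4*x^4)) * W"
    and "special_term q z K = (1 - q*x^6) * ((z*q^4-q*x^2)*(z*q^4-q^3*x^2)*(z-1)) / (q^4*(1-z*q)*(1-z*q^3)*(z-x^4)) * W"
proof -
  have x: "x \<noteq> 0" using q by (simp add: x_def)
  define c n A d g where "c = (\<Prod>j<K. (1-q^(4*j+2)) / (1-q^(4*j+4)))" and "n = (\<Prod>j<K. 1-z*q^(2*j+1))"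
    and "A = (\<Prod>j<K. z*q^4-q^(2*j+1))" and "d = (\<Prod>j<K. 1-z*q^(4*j+4))" and "g = (\<Prod>j<K. z-q^(4*j))"
  have W: "W = q^(K^2) * (c*n*A/(d*g)) / x^4"
    unfolding W_def c_def n_def A_def d_def g_def
    by (simp add: prod.distrib prod_dividef)
  have d0: "d \<noteq> 0" and g0: "g \<noteq> 0" using nz by (auto simp: d_def g_def)
  have pw: "q^(2*k) = (q^k)^2" "q^(4*k) = (q^k)^4" for k by (simp_all add: power_mult mult.commute flip: power_mult)
  have p1: "(\<Prod>j<K. 1-z*q^4*q^(2*j+1)) * ((1-z*q)*(1-z*q^3)) = n * ((1-z*q*x^2)*(1-z*q^3*x^2))"
    using prod_shift[of "\<lambda>j. 1-z*q^4*q^(2*j+1)" "\<lambda>k. (1-z*q*(q^k)^2)*(1-z*q^3*(q^k)^2)" "\<lambda>j. 1-z*q^(2*j+1)" K]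
    unfolding n_def x_def by (simp add: power_add pw power_mult_distrib eval_nat_numeral mult_ac)
  have p2: "(\<Prod>j<K. 1-z*q^4*q^(4*j+4)) * (1-z*q^4) = d * (1-z*q^4*x^4)"
    using prod_shift[of "\<lambda>j. 1-z*q^4*q^(4*j+4)" "\<lambda>k. 1-z*q^4*(q^k)^4" "\<lambda>j. 1-z*q^(4*j+4)" K]
    unfolding d_def x_def by (simp add: power_add pw power_mult_distrib eval_nat_numeral mult_ac)
  have p3: "(\<Prod>j<K. z*q^4-q^(4*j+4)) = x^4 * g"
    using prod_shift[of "\<lambda>j. z*q^4-q^(4*j+4)" "\<lambda>k. (q^k)^4" "\<lambda>j. z-q^(4*j)" K]
    unfolding g_def x_def by (simp add: power_add pw power_mult_distrib eval_nat_numeral algebra_simps)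
  have p4: "(\<Prod>j<K. z-q^(4*j+4)) * (z-1) = g * (z-x^4)"
    using prod_shift[of "\<lambda>j. z-q^(4*j+4)" "\<lambda>k. z-(q^k)^4" "\<lambda>j. z-q^(4*j)" K]
    unfolding g_def x_def by (simp add: power_add pw power_mult_distrib eval_nat_numeral mult_ac)
  have p5: "(\<Prod>j<K. z-q^(2*j+1)) * (q^4*(1-z*q)*(1-z*q^3)) * x^4 = A * ((z*q^4-q*x^2)*(z*q^4-q^3*x^2))"
  proof -
    have "(\<Prod>j<K. q^4*(z-q^(2*j+1))) * ((z*q^4-q*(q^0)^2)*(z*q^4-q^3*(q^0)^2)) = A * ((z*q^4-q*(q^K)^2)*(z*q^4-q^3*(q^K)^2))"
      unfolding A_def
    proof (rule prod_shift)
      fix k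
      show "q^4*(z-q^(2*k+1)) * ((z*q^4-q*(q^k)^2)*(z*q^4-q^3*(q^k)^2)) = (z*q^4-q^(2*k+1)) * ((z*q^4-q*(q^Suc k)^2)*(z*q^4-q^3*(q^Suc k)^2))"
        unfolding power_add pw power_Suc by algebra
    qed
    moreover have "(\<Prod>j<K. q^4*(z-q^(2*j+1))) = x^4 * (\<Prod>j<K. z-q^(2*j+1))"
      by (simp add: prod.distrib x_def flip: power_mult) (simp add: mult.commute)
    ultimately have e: "(x^4 * (\<Prod>j<K. z-q^(2*j+1))) * ((z*q^4-q)*(z*q^4-q^3)) = A * ((z*q^4-q*x^2)*(z*q^4-q^3*x^2))"
      by (simp only: x_def power_0 power_one mult_1_right)
    have "P * (q^4*(1-z*q)*(1-z*q^3)) * x^4 = (x^4*P) * ((z*q^4-q)*(z*q^4-q^3))" for P by algebra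
    thus ?thesis by (simp only: e)
  qed
  have x6: "q^(6*K+1) = q*x^6" by (simp add: x_def power_mult mult.commute)
  have t: "special_term q z' K = (1-q*x^6) * q^(K^2) * (c * ((\<Prod>j<K. 1-z'*q^(2*j+1)) * (\<Prod>j<K. z'-q^(2*j+1)))
      / ((\<Prod>j<K. 1-z'*q^(4*j+4)) * (\<Prod>j<K. z'-q^(4*j+4))))" for z'
    unfolding special_term_def c_def x6 by (simp add: prod.distrib prod_dividef)
  have nzs: "1-z*q \<noteq> 0" "1-z*q^3 \<noteq> 0" "1-z*q^4 \<noteq> 0" "z-1 \<noteq> 0" "1-z*q^4*x^4 \<noteq> 0" "z-x^4 \<noteq> 0"
    using nz(1)[of 1] nz(1)[of 3] nz(1)[of 4] nz(2)[of 0] nz(1)[of "4*K+4"] nz(2)[of K]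
    by (simp_all add: x_def power_add power_mult mult_ac)
  have e1: "(\<Prod>j<K. 1-z*q^4*q^(2*j+1)) = n * ((1-z*q*x^2)*(1-z*q^3*x^2)) / ((1-z*q)*(1-z*q^3))"
    using p1 nzs by (simp add: eq_divide_eq)
  have e2: "(\<Prod>j<K. 1-z*q^4*q^(4*j+4)) = d * (1-z*q^4*x^4) / (1-z*q^4)"
    using p2 nzs by (simp add: eq_divide_eq)
  have e4: "(\<Prod>j<K. z-q^(4*j+4)) = g * (z-x^4) / (z-1)"
    using p4 nzs by (simp add: eq_divide_eq)
  have e5: "(\<Prod>j<K. z-q^(2*j+1)) = A * ((z*q^4-q*x^2)*(z*q^4-q^3*x^2)) / (q^4*(1-z*q)*(1-z*q^3) * x^4)"
    using p5 nzs q x by (simp add: eq_divide_eq mult_ac)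
  have gen1: "X * s * (c * (n * (a*b) / (u*v) * A) / (d * e / f * (X4 * g))) = X * (a*b*f) / (u*v*e) * (s * (c*n*A/(d*g)) / X4)"
    if "d \<noteq> 0" "g \<noteq> 0" "u \<noteq> 0" "v \<noteq> 0" "e \<noteq> 0" "X4 \<noteq> 0" for X s a b u v e f X4
    using that by (simp add: divide_simps)
  have gen2: "X * s * (c * (n * (A * (a*b) / (u * X4))) / (d * (g * e / f))) = X * (a*b*f) / (u*e) * (s * (c*n*A/(d*g)) / X4)"
    if "d \<noteq> 0" "g \<noteq> 0" "u \<noteq> 0" "e \<noteq> 0" "X4 \<noteq> 0" for X s a b u e f X4
    using that by (simp add: divide_simps)
  show "special_term q (z*q^4) K = (1 - q*x^6) * ((1-z*q*x^2)*(1-z*q^3*x^2)*(1-z*q^4)) / ((1-z*q)*(1-z*q^3)*(1-z*q^4*x^4)) * W"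
    unfolding t W e1 e2 p3 A_def[symmetric] by (rule gen1) (use nzs d0 g0 x in auto)
  show "special_term q z K = (1 - q*x^6) * ((z*q^4-q*x^2)*(z*q^4-q^3*x^2)*(z-1)) / (q^4*(1-z*q)*(1-z*q^3)*(z-x^4)) * W"
    unfolding t W e5 e4 n_def[symmetric] d_def[symmetric] by (rule gen2) (use nzs d0 g0 x q in auto)
qed

text \<open>WZ summation: the combination of the two terms is \<open>G (Suc k) - G k\<close>. Both
  ends vanish, \<open>G 0\<close> because of \<open>1 - (q^0)^4\<close>, and \<open>G K\<close>
  because \<open>W K\<close> contains the factor with \<open>j = M\<close>, which is zero by
  \<open>van\<close>.\<close>

lemma special_term_sum_shift:
  fixes q z :: "'a::field" and K :: nat
  assumes q: "q \<noteq> 0" and nz: "\<And>j. 1 - z*q^j \<noteq> 0" "\<And>j. z - q^(4*j) \<noteq> 0"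
      "\<And>j. 1 - q^(4*j+4) \<noteq> 0"
    and van: "z * q^4 = q^(2*M+1)" "M < K"
  shows "(\<Sum>k<K. special_term q (z*q^4) k) = (1-z*q^4)/((1-z)*q^2) * (\<Sum>k<K. special_term q z k)"
proof -
  define W where "W = (\<lambda>K. q^(K^2) * (\<Prod>j<K. (1-q^(4*j+2)) / (1-q^(4*j+4)) * (1-z*q^(2*j+1)) * (z*q^4-q^(2*j+1))
                    / ((1-z*q^(4*j+4)) * (z-q^(4*j)))) / (q^K)^4)"
  define C where "C = -((1-z*q^4)*(1+z*q^2)/(q*(1-z*q)*(1-z*q^3)))"
  define G where "G = (\<lambda>K. C * ((q-(q^K)^2)*(1-(q^K)^4)) * W K)"
  have "(\<Sum>k<K. special_term q (z*q^4) k - (1-z*q^4)/((1-z)*q^2) * special_term q z k) = G K"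
  proof (rule telescoped_sum)
    show "G 0 = 0" by (simp add: G_def)
    fix k
    define x where "x = q^k"
    have nzs: "1-z*q \<noteq> 0" "1-z*q^3 \<noteq> 0" "1-z*q^4 \<noteq> 0" "z \<noteq> 1" "1-z*q^4*x^4 \<noteq> 0" "z-x^4 \<noteq> 0" "1-q^4*x^4 \<noteq> 0" "x \<noteq> 0"
      using nz(1)[of 1] nz(1)[of 3] nz(1)[of 4] nz(2)[of 0] nz(1)[of "4*k+4"] nz(2)[of k] nz(3)[of k] q
      by (simp_all add: x_def power_add power_mult mult_ac)
    have W: "W (Suc k) = W k * (q*x^2*(1-q^2*x^4)*(1-z*q*x^2)*(z*q^4-q*x^2)/((1-q^4*x^4)*(1-z*q^4*x^4)*(z-x^4))) / q^4"
    proof -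
      have f: "q^(4*k+2) = q^2*x^4" "q^(4*k+4) = q^4*x^4" "q^(2*k+1) = q*x^2" "q^(4*k) = x^4" "q^Suc k = q*x" "q^k = x"
         "q^((Suc k)^2) = q^(k^2)*(q*x^2)"
        by (simp_all add: x_def power_add power_mult power2_eq_square mult_ac flip: power_mult_distrib)
      have a: "z*(q*x^2) = z*q*x^2" "z*(q^4*x^4) = z*q^4*x^4" by algebra+
      show ?thesis unfolding W_def prod.lessThan_Suc f a
        using nzs q by (simp add: divide_simps power_mult_distrib)
    qed
    have "G (Suc k) - G k = C * ((q-q^2*x^2)*(1-q^4*x^4)/q^4
          * (q*x^2*(1-q^2*x^4)*(1-z*q*x^2)*(z*q^4-q*x^2)/((1-q^4*x^4)*(1-z*q^4*x^4)*(z-x^4))) - (q-x^2)*(1-x^4)) * W k"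
    proof -
      have gen: "C*(a*b)*(w*r/q4) - C*(c*d)*w = C*(a*b/q4*r - c*d)*w" for a b c d w r q4
        by (simp add: algebra_simps)
      have e: "(q^Suc k)^2 = q^2*x^2" "(q^Suc k)^4 = q^4*x^4" by (simp_all add: x_def power_mult_distrib)
      show ?thesis unfolding G_def W e x_def[symmetric] by (rule gen)
    qed
    also have "\<dots> = special_term q (z*q^4) k - (1-z*q^4)/((1-z)*q^2) * special_term q z k"
    proof -
      have gen: "(a - r*b)*w = a*w - r*(b*w)" for a b r w :: 'a by (simp add: algebra_simps)
      show ?thesis
        unfolding C_def special_term_step_aux[OF q nzs(8) nzs(4) nzs(1,2) nzs(5,6,7) nzs(3), symmetric]
        unfolding special_term_shift[OF q nz, of k] W_def x_def by (rule gen)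
    qed
    finally show "special_term q (z*q^4) k - (1-z*q^4)/((1-z)*q^2) * special_term q z k = G (Suc k) - G k" by simp
  qed
  also have "G K = 0"
  proof -
    have "W K = 0" unfolding W_def using van by auto
    thus ?thesis by (simp add: G_def)
  qed
  finally show ?thesis by (simp add: sum_subtractf sum_distrib_left)
qed

lemma power_eq_imp_eq_exponent:
  fixes q :: "'a::field"
  assumes "q \<noteq> 0" "\<And>i. i > 0 \<Longrightarrow> q^i \<noteq> 1" "q^a = q^b"
  shows "a = b"
proof -
  have *: False if "a < b" "q^a = q^b" for a b
  proof -
    have "q^a * q^(b-a) = q^b" using that(1) by (simp flip: power_add)
    hence "q^a * q^(b-a) = q^a * 1" using that(2) by simp
    hence "q^(b-a) = 1" using assms(1) by simp
    thus False using assms(2)[of "b-a"] that by simp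
  qed
  show ?thesis using *[of a b] *[of b a] assms(3) by (metis nat_neq_iff)
qed

lemma special_term_eq_0: "special_term q (q^(2*M+1)) k = 0" if "M < k"
  using that unfolding special_term_def by (auto intro!: prod_zero bexI[of _ M])

text \<open>The shift from \<open>z\<close> to \<open>z q^4\<close> raises the exponent
  \<open>2M+1\<close> by four. The induction therefore steps from \<open>M - 2\<close> to
  \<open>M\<close> and has the two base cases \<open>M = 0\<close> and \<open>M = 1\<close>.\<close>

lemma special_term_sum:
  fixes q :: "'a::field"
  assumes q: "q \<noteq> 0" and nr: "\<And>i. i > 0 \<Longrightarrow> q^i \<noteq> 1" and "M < K"
  shows "q^M * (\<Sum>k<K. special_term q (q^(2*M+1)) k) = (-1)^M * (1 - q^(2*M+1))"
  using assms(3)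
proof (induction M rule: less_induct)
  case (less M)
  have trunc: "(\<Sum>k<K. special_term q (q^(2*M+1)) k) = (\<Sum>k\<le>M. special_term q (q^(2*M+1)) k)"
  proof (rule sum.mono_neutral_right)
    show "\<forall>k\<in>{..<K} - {..M}. special_term q (q^(2*M+1)) k = 0"
      by (intro ballI special_term_eq_0) simp
  qed (use less.prems in auto)
  consider "M = 0" | "M = 1" | M' where "M = Suc (Suc M')"
    by (metis One_nat_def not0_implies_Suc)
  thus ?case
  proof cases
    case 1
    thus ?thesis unfolding trunc by (simp add: special_term_def)
  next
    case 2
    have n: "1 - q \<noteq> 0" "1 - q^4 \<noteq> 0" "1 - q^7 \<noteq> 0" using nr[of 1] nr[of 4] nr[of 7] by simp_all
    have e: "q^3 - q^4 = q^3*(1-q)" "q^3 - q = q*(q^2-1)" "1 - q^3*q^4 = 1-q^7" "1-q^3*q=1-q^4" by algebra+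
    have "special_term q (q^3) 1 = (1-q^7) * q * ((1-q^2)*((1-q^4)*(q*(q^2-1))) / ((1-q^4)*((1-q^7)*(q^3*(1-q)))))"
    proof -
      have r: "{..<1} = {0::nat}" "6*1+1 = (7::nat)" "1\<^sup>2 = (1::nat)" "4*0+2=(2::nat)" "2*0+1=(1::nat)" "4*0+4=(4::nat)" by auto
      show ?thesis unfolding e(1-3)[symmetric] special_term_def r using n e(4) by (simp add: r power2_eq_square)
    qed
    also have "\<dots> = (1-q^2)*(q*q*(q^2-1)) / (q^3*(1-q))"
      using n q by (simp add: divide_simps)
    also have "\<dots> = - ((1-q^2)*(1+q)) / q"
    proof -
      have f: "1-q^2 = (1-q)*(1+q)" "q^2-1 = -((1-q)*(1+q))" "q^3=q*q*q" by algebra+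
      show ?thesis unfolding f using n q by (simp add: divide_simps)
    qed
    finally have "special_term q (q^3) 1 = - ((1-q^2)*(1+q)) / q" .
    moreover have "special_term q (q^3) 0 = 1 - q" by (simp add: special_term_def)
    ultimately have "(\<Sum>k\<le>M. special_term q (q^(2*M+1)) k) = 1 - q - ((1-q^2)*(1+q)) / q"
      using 2 by (simp add: eval_nat_numeral)
    moreover have "q * (1 - q - ((1-q^2)*(1+q)) / q) = -(1-q^3)"
    proof -
      have "q * (1 - q - ((1-q^2)*(1+q)) / q) = q*(1-q) - (1-q^2)*(1+q)" using q by (simp add: divide_simps)
      thus ?thesis by algebra
    qed
    ultimately show ?thesis unfolding trunc using 2 by (simp add: eval_nat_numeral)
  next
    case 3
    define z where "z = q^(2*M'+1)"
    have zq: "z*q^4 = q^(2*M+1)"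
    proof -
      have "2*M+1 = 2*M'+1+4" by (simp add: 3)
      thus ?thesis by (simp only: z_def power_add)
    qed
    have n1: "1 - z*q^j \<noteq> 0" for j using nr[of "2*M'+1+j"] unfolding z_def power_add by simp
    have n2: "z - q^(4*j) \<noteq> 0" for j
    proof
      assume "z - q^(4*j) = 0"
      hence "2*M'+1 = 4*j" by (intro power_eq_imp_eq_exponent[OF q nr]) (auto simp: z_def)
      thus False by presburger
    qed
    have n3: "1 - q^(4*j+4) \<noteq> 0" for j using nr[of "4*j+4"] by simp
    have "(\<Sum>k<K. special_term q (q^(2*M+1)) k) = (1-z*q^4)/((1-z)*q^2) * (\<Sum>k<K. special_term q z k)"
      unfolding zq[symmetric] by (rule special_term_sum_shift[OF q n1 n2 n3 zq less.prems])
    moreover have "q^M' * (\<Sum>k<K. special_term q z k) = (-1)^M' * (1-z)" unfolding z_def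
      by (rule less.IH) (use 3 less.prems in auto)
    moreover have "q^M = q^M' * q^2" by (simp add: 3 power2_eq_square)
    moreover have "1 - z \<noteq> 0" using n1[of 0] by simp
    moreover have "q^M' * q^2 * (c / ((1-z)*q^2) * T) = c / (1-z) * (q^M' * T)" for c T
      using q \<open>1 - z \<noteq> 0\<close> by (simp add: divide_simps)
    ultimately have "q^M * (\<Sum>k<K. special_term q (q^(2*M+1)) k) = (1-z*q^4) / (1-z) * ((-1)^M' * (1-z))"
      by (simp only:)
    thus ?thesis using \<open>1 - z \<noteq> 0\<close> by (simp add: zq 3)
  qed
qed

text \<open>With \<open>y = a + 1/a - 2\<close> this is \<open>(1 - a q^i)(1 - q^i/a)\<close>.\<close>

definition qquad :: "'a::field \<Rightarrow> 'a \<Rightarrow> nat \<Rightarrow> 'a" where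
  "qquad q y i = (1 - q^i)^2 - y * q^i"

text \<open>Up to the factor \<open>1 - q\<close>, the parametric summand with \<open>(q\<^sup>2;q\<^sup>4)\<^sub>k\<close> deformed so that the series
  terminates for \<open>z = q^(4M)\<close> and every \<open>y\<close>; if \<open>q\<close> is a root of unity of order \<open>2M+1\<close>, then
  \<open>q^(4M) = q^(-2)\<close> and the deformation is trivial.\<close>

definition deformed_term :: "'a::field \<Rightarrow> 'a \<Rightarrow> 'a \<Rightarrow> nat \<Rightarrow> 'a" where
  "deformed_term q y z k = (1 - q^(6*k+1)) * q^(k^2) * (\<Prod>j<k. (1-q^(2*j+1)) * qquad q y (2*j+1) * (z-q^(4*j)) * q^2
       / ((1-q^(4*j+4)) * qquad q y (4*j+4) * (1-z*q^(2*j+3))))"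

text \<open>The WZ certificate of \<open>deformed_term\<close> for the shift from \<open>z\<close>
  to \<open>z q^4\<close>, with \<open>x = q^k\<close> and denominators cleared.\<close>

lemma certificate_deformed_term:
  fixes q x z y :: "'a::field"
  shows "(1-q*x^6)*(((1-z*q^4)^2-y*(z*q^4))*(z*q^4-1)*x^4-(z*q^4-x^4)*(1-z*q^3*x^2)*(1-z*q^5*x^2))
   = z*(q^3*x^2*(1-q*x^2)*((1-q*x^2)^2-y*(q*x^2))*(z*q^4-x^4)-q^4*(1-x^4)*((1-x^4)^2-y*x^4)*(1-z*q^5*x^2))"
  by algebra

text \<open>Telescoping as in \<open>special_term_sum_shift\<close>. Here the upper end vanishes
  through the factor \<open>z q^4 - q^(4j)\<close> at \<open>j = M + 1\<close>, which explains the
  bound \<open>M + 1 < K\<close>.\<close>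

lemma deformed_term_sum_shift:
  fixes q z y :: "'a::field" and K :: nat
  assumes q: "q \<noteq> 0" and nz: "\<And>j. 1 - z*q^(j+1) \<noteq> 0"
      "\<And>j. 1 - q^(4*j+4) \<noteq> 0" "\<And>j. qquad q y (4*j+4) \<noteq> 0"
    and van: "z = q^(4*M)" "M + 1 < K"
  shows "(\<Sum>k<K. deformed_term q y (z*q^4) k) = (1-z*q^3)*(1-z*q^5)/qquad q y (4*M+4) * (\<Sum>k<K. deformed_term q y z k)"
proof -
  define Yn where "Yn = (1-z*q^4)^2-y*(z*q^4)"
  have Yn: "Yn = qquad q y (4*M+4)" by (simp add: Yn_def qquad_def van(1) power_add)
  have Yn0: "Yn \<noteq> 0" unfolding Yn by (rule nz)
  define W where "W = (\<lambda>K. q^(K^2) * (\<Prod>j<K. (1-q^(2*j+1)) * qquad q y (2*j+1) * (z*q^4-q^(4*j)) * q^2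
       / ((1-q^(4*j+4)) * qquad q y (4*j+4) * (1-z*q^(2*j+3)))))"
  define G where "G = (\<lambda>K. z*((1-z*q^3)*(1-z*q^5))/Yn * ((1-(q^K)^4)*((1-(q^K)^4)^2-y*(q^K)^4)) * q^4 /
        ((q^K)^4*(z*q^4-1)*(1-z*q^3*(q^K)^2)) * W K)"
  have nz0: "1-z*q^3 \<noteq> 0" "1-z*q^5 \<noteq> 0" "z*q^4-1 \<noteq> 0" "1-z*q^4 \<noteq> 0"
    using nz(1)[of 2] nz(1)[of 4] nz(1)[of 3] by (auto simp: mult.assoc power_Suc)
  have pw: "q^(2*k) = (q^k)^2" "q^(4*k) = (q^k)^4" for k by (simp_all add: power_mult mult.commute flip: power_mult)
  have "(\<Sum>k<K. deformed_term q y (z*q^4) k - (1-z*q^3)*(1-z*q^5)/Yn * deformed_term q y z k) = G K"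
  proof (rule telescoped_sum)
    show "G 0 = 0" by (simp add: G_def)
    fix k
    define x where "x = q^k"
    define P3 P5 where "P3 = 1-z*q^3*x^2" and "P5 = 1-z*q^5*x^2"
    define Y1 Y0 Y4 where "Y1 = (1-q*x^2)^2-y*(q*x^2)" and "Y0 = (1-x^4)^2-y*x^4" and "Y4 = qquad q y (4*k+4)"
    have nzs: "x \<noteq> 0" "1-q^4*x^4 \<noteq> 0" "P3 \<noteq> 0" "P5 \<noteq> 0" "Y4 \<noteq> 0"
      using nz(2)[of k] nz(1)[of "2*k+2"] nz(1)[of "2*k+4"] nz(3)[of k] q
      by (simp_all add: x_def P3_def P5_def Y4_def power_add pw eval_nat_numeral mult_ac)
    have f: "q^(4*k+4) = q^4*x^4" "q^(2*k+1) = q*x^2" "q^(4*k) = x^4" "q^Suc k = q*x" "q^k = x"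
         "q^((Suc k)^2) = q^(k^2)*(q*x^2)" "q^(2*k+3) = q^3*x^2" "q^(6*k+1) = q*x^6"
      by (simp_all add: x_def power_add power_mult power2_eq_square mult_ac flip: power_mult_distrib)
    have Y1: "qquad q y (2*k+1) = Y1" unfolding qquad_def Y1_def f ..
    have "W (Suc k) = W k * (q*x^2*(1-q*x^2)*Y1*(z*q^4-x^4)*q^2/((1-q^4*x^4)*Y4*P3))"
    proof -
      have a: "z*(q^3*x^2) = z*q^3*x^2" by algebra
      show ?thesis unfolding W_def prod.lessThan_Suc f a Y1 Y4_def P3_def
        using nzs q by simp
    qed
    moreover have "(1-(q*x)^4) = 1-q^4*x^4" "(1-(q*x)^4)^2-y*(q*x)^4 = Y4" "1-z*q^3*(q*x)^2 = P5"
      unfolding Y4_def qquad_def f P5_def by algebra+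
    ultimately have GS: "G (Suc k) = z*((1-z*q^3)*(1-z*q^5))/Yn * ((1-q^4*x^4)*Y4) * q^4 / ((q*x)^4*(z*q^4-1)*P5)
          * (W k * (q*x^2*(1-q*x^2)*Y1*(z*q^4-x^4)*q^2/((1-q^4*x^4)*Y4*P3)))"
      unfolding G_def f by simp
    have G0: "G k = z*((1-z*q^3)*(1-z*q^5))/Yn * ((1-x^4)*Y0) * q^4 / (x^4*(z*q^4-1)*P3) * W k"
      unfolding G_def f Y0_def P3_def ..
    have c1: "(\<Prod>j<k. 1-z*q^4*q^(2*j+3)) * ((1-z*q^3)*(1-z*q^5)) = (\<Prod>j<k. 1-z*q^(2*j+3)) * (P3*P5)"
      using prod_shift[of "\<lambda>j. 1-z*q^4*q^(2*j+3)" "\<lambda>k. (1-z*q^3*(q^k)^2)*(1-z*q^5*(q^k)^2)" "\<lambda>j. 1-z*q^(2*j+3)" k]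
      unfolding x_def P3_def P5_def by (simp add: power_add pw power_mult_distrib eval_nat_numeral mult_ac)
    have c2: "x^4*(\<Prod>j<k. z-q^(4*j)) * (z*q^4-1) = (\<Prod>j<k. z*q^4-q^(4*j)) * (z*q^4-x^4)"
    proof -
      have "(\<Prod>j<k. q^4*(z-q^(4*j))) * (z*q^4-(q^0)^4) = (\<Prod>j<k. z*q^4-q^(4*j)) * (z*q^4-(q^k)^4)"
      proof (rule prod_shift)
        fix k
        show "q^4*(z-q^(4*k)) * (z*q^4-(q^k)^4) = (z*q^4-q^(4*k)) * (z*q^4-(q^Suc k)^4)"
          unfolding pw power_Suc by algebra
      qed
      moreover have "(\<Prod>j<k. q^4*(z-q^(4*j))) = x^4 * (\<Prod>j<k. z-q^(4*j))"
        by (simp add: prod.distrib x_def flip: power_mult) (simp add: mult.commute)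
      ultimately show ?thesis by (simp add: x_def)
    qed
    define c A d where "c = (\<Prod>j<k. (1-q^(2*j+1)) * qquad q y (2*j+1) * q^2 / ((1-q^(4*j+4)) * qquad q y (4*j+4)))"
      and "A = (\<Prod>j<k. z*q^4-q^(4*j))" and "d = (\<Prod>j<k. 1-z*q^(2*j+3))"
    have d0: "d \<noteq> 0" unfolding d_def using nz(1)[of "2*_+2"] by (auto simp: eval_nat_numeral)
    have t: "deformed_term q y z' k = (1-q*x^6) * q^(k^2) * (c * (\<Prod>j<k. z'-q^(4*j)) / (\<Prod>j<k. 1-z'*q^(2*j+3)))" for z'
      unfolding deformed_term_def c_def f by (simp add: prod.distrib prod_dividef)
    have Wk: "W k = q^(k^2) * (c*A/d)"
      unfolding W_def c_def A_def d_def by (simp add: prod.distrib prod_dividef)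
    have e1: "(\<Prod>j<k. 1-z*q^4*q^(2*j+3)) = d * (P3*P5) / ((1-z*q^3)*(1-z*q^5))"
      using c1 nz0 unfolding d_def by (simp add: eq_divide_eq)
    have e2: "(\<Prod>j<k. z-q^(4*j)) = A * (z*q^4-x^4) / (x^4*(z*q^4-1))"
      using c2 nz0 nzs unfolding A_def by (simp add: eq_divide_eq mult_ac)
    have t2a: "deformed_term q y (z*q^4) k = (1-q*x^6) * ((1-z*q^3)*(1-z*q^5)) / (P3*P5) * W k"
      unfolding t e1 A_def[symmetric] Wk using nz0 nzs d0 by (simp add: divide_simps)
    have t2b: "deformed_term q y z k = (1-q*x^6) * (z*q^4-x^4) / (x^4*(z*q^4-1)) * W k"
      unfolding t e2 d_def[symmetric] Wk using nz0 nzs d0 by (simp add: divide_simps)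
    \<comment> \<open>The certificate in the abbreviations above. Below, \<open>gL\<close> and
      \<open>gR\<close> give both sides of the WZ equation the same prefactor, so that exactly this
      identity is left.\<close>
    have key: "(1-q*x^6)*(Yn*(z*q^4-1)*x^4-(z*q^4-x^4)*P3*P5)
      = z*(q^3*x^2*(1-q*x^2)*Y1*(z*q^4-x^4)-q^4*(1-x^4)*Y0*P5)"
      unfolding Yn_def P3_def P5_def Y1_def Y0_def by (rule certificate_deformed_term)
    have gL: "b * C / (P3*P5) * w - C/Yn * (b*v/(X*u)*w) = C*w/(P3*P5*Yn*X*u) * (b*(Yn*u*X-v*P3*P5))"
      if "X \<noteq> 0" "u \<noteq> 0" for b C w v X u
      using that nzs Yn0 by (simp add: divide_simps) (simp add: algebra_simps)
    have gR: "z*C/Yn * (a*Y4) * q^4 / (q^4*X*u*P5) * (w * (q*x2*m*Y1*v*q^2/(a*Y4*P3))) - z*C/Yn * (l*Y0) * q^4 / (X*u*P3) * w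
       = C*w/(P3*P5*Yn*X*u) * (z*(q^3*x2*m*Y1*v-q^4*l*Y0*P5))" if "X \<noteq> 0" "u \<noteq> 0" "a \<noteq> 0" for C a X u w x2 m v l
      using that nzs Yn0 q by (simp add: divide_simps) (simp add: algebra_simps eval_nat_numeral)
    show "deformed_term q y (z*q^4) k - (1-z*q^3)*(1-z*q^5)/Yn * deformed_term q y z k = G (Suc k) - G k"
      unfolding t2a t2b GS G0 power_mult_distrib
      by (subst gL, use nzs in simp, use nz0 in simp, subst gR, use nzs in simp, use nz0 in simp, use nzs in simp)
         (simp only: key)
  qed
  also have "G K = 0"
  proof -
    have "(\<Prod>j<K. (1-q^(2*j+1)) * qquad q y (2*j+1) * (z*q^4-q^(4*j)) * q^2
       / ((1-q^(4*j+4)) * qquad q y (4*j+4) * (1-z*q^(2*j+3)))) = 0"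
      using van by (intro prod_zero bexI[of _ "M+1"]) (auto simp: power_add)
    thus ?thesis by (simp add: G_def W_def)
  qed
  finally show ?thesis by (simp add: sum_subtractf sum_distrib_left Yn)
qed

text \<open>Induction on \<open>M\<close> by the shift. What matters is the numerator: it contains
  \<open>1 - q^(2M+1)\<close>, so the closed form tends to zero at a root of unity of order
  \<open>2M+1\<close> as long as the denominator stays away from zero.\<close>

lemma deformed_term_sum:
  fixes q y :: "'a::field"
  assumes q: "q \<noteq> 0" and nr: "\<And>i. i > 0 \<Longrightarrow> q^i \<noteq> 1" and nY: "\<And>j. qquad q y (4*j+4) \<noteq> 0" and "M < K"
  shows "(\<Sum>k<K. deformed_term q y (q^(4*M)) k) = (\<Prod>j\<le>2*M. 1 - q^(2*j+1)) / (\<Prod>j<M. qquad q y (4*j+4))"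
  using assms(4)
proof (induction M)
  case 0
  have "(\<Sum>k<K. deformed_term q y 1 k) = (\<Sum>k\<in>{0}. deformed_term q y 1 k)"
    using 0 by (intro sum.mono_neutral_right) (auto simp: deformed_term_def intro!: prod_zero bexI[of _ 0])
  thus ?case by (simp add: deformed_term_def)
next
  case (Suc M)
  have "(\<Sum>k<K. deformed_term q y (q^(4*M)*q^4) k) = (1-q^(4*M)*q^3)*(1-q^(4*M)*q^5)/qquad q y (4*M+4) * (\<Sum>k<K. deformed_term q y (q^(4*M)) k)"
  proof (rule deformed_term_sum_shift[OF q _ _ nY refl])
    show "1 - q^(4*M) * q^(j+1) \<noteq> 0" for j using nr[of "4*M+(j+1)"] by (simp add: power_add mult_ac)
    show "1 - q^(4*j+4) \<noteq> 0" for j using nr[of "4*j+4"] by simp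
  qed (use Suc.prems in simp)
  also have "\<dots> = (1-q^(4*M)*q^3)*(1-q^(4*M)*q^5)/qquad q y (4*M+4) * ((\<Prod>j\<le>2*M. 1 - q^(2*j+1)) / (\<Prod>j<M. qquad q y (4*j+4)))"
    using Suc by simp
  also have "\<dots> = (\<Prod>j\<le>2*Suc M. 1 - q^(2*j+1)) / (\<Prod>j<Suc M. qquad q y (4*j+4))"
  proof -
    have h: "2 * Suc M = Suc (Suc (2*M))" "2 * Suc (2*M) + 1 = 4*M+3" "2 * Suc (Suc (2*M)) + 1 = 4*M+5" by simp_all
    have "(\<Prod>j\<le>2*Suc M. 1 - q^(2*j+1)) = (1-q^(4*M)*q^3)*(1-q^(4*M)*q^5) * (\<Prod>j\<le>2*M. 1 - q^(2*j+1))"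
      by (simp only: prod.atMost_Suc h) (simp only: power_add mult_ac)
    moreover have "(\<Prod>j<Suc M. qquad q y (4*j+4)) = qquad q y (4*M+4) * (\<Prod>j<M. qquad q y (4*j+4))" by (simp add: mult.commute)
    ultimately show ?thesis by (simp only: times_divide_times_eq)
  qed
  finally show ?case by (simp add: power_add mult.commute)
qed

section \<open>The local ring at a point\<close>

definition qconst :: "complex \<Rightarrow> ratfun" where
  "qconst c = to_fract [:c:]"

lemma qconst_simps [simp]:
  "qconst 0 = 0" "qconst 1 = 1" "qconst (a + b) = qconst a + qconst b" "qconst (a - b) = qconst a - qconst b"
  "qconst (a * b) = qconst a * qconst b" "qconst (-a) = - qconst a" "qconst a = qconst b \<longleftrightarrow> a = b"
  by (simp_all add: qconst_def flip: to_fract_mult one_pCons)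
     (simp_all flip: to_fract_add to_fract_diff to_fract_uminus to_fract_1)

lemma qconst_power [simp]: "qconst (a ^ n) = qconst a ^ n"
  by (induction n) auto

text \<open>A relation instead of an evaluation map: it records regularity at \<open>\<zeta>\<close>
  and the value together and propagates through introduction rules. The elements that have a value
  form the local ring at \<open>\<zeta>\<close>.\<close>

definition hval :: "complex \<Rightarrow> ratfun \<Rightarrow> complex \<Rightarrow> bool" where
  "hval \<zeta> x c \<longleftrightarrow> (\<exists>N D. poly D \<zeta> \<noteq> 0 \<and> x = to_fract N / to_fract D \<and> c = poly N \<zeta> / poly D \<zeta>)"

lemma poly_nz: "poly D \<zeta> \<noteq> 0 \<Longrightarrow> D \<noteq> 0" by auto

lemma hval_to_fract: "hval \<zeta> (to_fract p) (poly p \<zeta>)"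
  unfolding hval_def by (intro exI[of _ p] exI[of _ 1]) simp

lemma hval_const [intro]: "hval \<zeta> (qconst c) c"
  using hval_to_fract[of \<zeta> "[:c:]"] by (simp add: qconst_def)

lemma hval_0 [intro]: "hval \<zeta> 0 0" using hval_const[of \<zeta> 0] by simp
lemma hval_1 [intro]: "hval \<zeta> 1 1" using hval_const[of \<zeta> 1] by simp

lemma hval_qX [intro]: "hval \<zeta> qX \<zeta>"
  using hval_to_fract[of \<zeta> "[:0,1:]"] by (simp add: qX_def)

lemma hval_add [intro]: assumes "hval \<zeta> x a" "hval \<zeta> y b" shows "hval \<zeta> (x + y) (a + b)"
proof -
  from assms obtain N D N' D' where *: "poly D \<zeta> \<noteq> 0" "x = to_fract N / to_fract D" "a = poly N \<zeta> / poly D \<zeta>"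
    "poly D' \<zeta> \<noteq> 0" "y = to_fract N' / to_fract D'" "b = poly N' \<zeta> / poly D' \<zeta>" unfolding hval_def by blast
  have "D \<noteq> 0" "D' \<noteq> 0" using * by auto
  thus ?thesis unfolding hval_def using *
    by (intro exI[of _ "N * D' + N' * D"] exI[of _ "D * D'"]) (simp add: add_frac_eq)
qed

lemma hval_mult [intro]: assumes "hval \<zeta> x a" "hval \<zeta> y b" shows "hval \<zeta> (x * y) (a * b)"
proof -
  from assms obtain N D N' D' where *: "poly D \<zeta> \<noteq> 0" "x = to_fract N / to_fract D" "a = poly N \<zeta> / poly D \<zeta>"
    "poly D' \<zeta> \<noteq> 0" "y = to_fract N' / to_fract D'" "b = poly N' \<zeta> / poly D' \<zeta>" unfolding hval_def by blast
  thus ?thesis unfolding hval_def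
    by (intro exI[of _ "N * N'"] exI[of _ "D * D'"]) simp
qed

lemma hval_inverse: assumes "hval \<zeta> x a" "a \<noteq> 0" shows "hval \<zeta> (inverse x) (inverse a)"
proof -
  from assms obtain N D where *: "poly D \<zeta> \<noteq> 0" "x = to_fract N / to_fract D" "a = poly N \<zeta> / poly D \<zeta>"
    unfolding hval_def by blast
  thus ?thesis unfolding hval_def using assms(2)
    by (intro exI[of _ D] exI[of _ N]) simp
qed

lemma hval_divide [intro]: "hval \<zeta> x a \<Longrightarrow> hval \<zeta> y b \<Longrightarrow> b \<noteq> 0 \<Longrightarrow> hval \<zeta> (x / y) (a / b)"
  unfolding divide_inverse by (intro hval_mult hval_inverse)

lemma hval_uminus [intro]: "hval \<zeta> x a \<Longrightarrow> hval \<zeta> (- x) (- a)"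
  using hval_mult[OF hval_const[of \<zeta> "-1"], of x a] by simp

lemma hval_diff [intro]: "hval \<zeta> x a \<Longrightarrow> hval \<zeta> y b \<Longrightarrow> hval \<zeta> (x - y) (a - b)"
  using hval_add[OF _ hval_uminus, of \<zeta> x a y b] by simp

lemma hval_power [intro]: "hval \<zeta> x a \<Longrightarrow> hval \<zeta> (x ^ n) (a ^ n)"
  by (induction n) auto

lemma hval_sum [intro]: "(\<And>i. i \<in> A \<Longrightarrow> hval \<zeta> (f i) (g i)) \<Longrightarrow> hval \<zeta> (sum f A) (sum g A)"
  by (induction A rule: infinite_finite_induct) auto

lemma hval_prod [intro]: "(\<And>i. i \<in> A \<Longrightarrow> hval \<zeta> (f i) (g i)) \<Longrightarrow> hval \<zeta> (prod f A) (prod g A)"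
  by (induction A rule: infinite_finite_induct) auto

text \<open>Cross-multiplying two representations gives a polynomial identity, which can be
  evaluated at \<open>\<zeta>\<close>. Computing one value in two ways is how sums at roots of unity
  are shown to vanish.\<close>

lemma hval_unique: assumes "hval \<zeta> x a" "hval \<zeta> x b" shows "a = b"
proof -
  from assms obtain N D N' D' where *: "poly D \<zeta> \<noteq> 0" "x = to_fract N / to_fract D" "a = poly N \<zeta> / poly D \<zeta>"
    "poly D' \<zeta> \<noteq> 0" "x = to_fract N' / to_fract D'" "b = poly N' \<zeta> / poly D' \<zeta>" unfolding hval_def by blast
  have "to_fract (N * D') = to_fract (N' * D)"
    using * poly_nz[of D \<zeta>] poly_nz[of D' \<zeta>] by (simp add: divide_simps)
  hence "poly (N * D') \<zeta> = poly (N' * D) \<zeta>" by (simp only: to_fract_eq_iff)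
  thus ?thesis unfolding *(3,6) using *(1,4) by (simp add: frac_eq_eq)
qed

section \<open>Orders of vanishing at a point\<close>

definition qlin :: "complex \<Rightarrow> ratfun" where "qlin \<zeta> = qX - qconst \<zeta>"

lemma qlin_eq: "qlin \<zeta> = to_fract [:-\<zeta>, 1:]"
  by (simp add: qlin_def qX_def qconst_def flip: to_fract_diff)

lemma qlin_nz [simp]: "qlin \<zeta> \<noteq> 0" by (simp add: qlin_eq)

text \<open>\<open>vge \<zeta> k x\<close>: \<open>x\<close> vanishes at \<open>\<zeta>\<close> to order at least \<open>k\<close>, where \<open>k\<close> may be negative.\<close>

definition vge :: "complex \<Rightarrow> int \<Rightarrow> ratfun \<Rightarrow> bool" where
  "vge \<zeta> k x \<longleftrightarrow> (\<exists>c y. hval \<zeta> y c \<and> x = qlin \<zeta> powi k * y)"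

lemma vge_0_iff: "vge \<zeta> 0 x \<longleftrightarrow> (\<exists>c. hval \<zeta> x c)"
  by (auto simp: vge_def)

lemma vge_hval: "hval \<zeta> x c \<Longrightarrow> vge \<zeta> 0 x" by (auto simp: vge_0_iff)

lemma vge_mult: assumes "vge \<zeta> k x" "vge \<zeta> l y" shows "vge \<zeta> (k + l) (x * y)"
proof -
  from assms obtain c x' d y' where "hval \<zeta> x' c" "x = qlin \<zeta> powi k * x'" "hval \<zeta> y' d" "y = qlin \<zeta> powi l * y'"
    unfolding vge_def by blast
  thus ?thesis unfolding vge_def
    by (intro exI[of _ "c*d"] exI[of _ "x'*y'"]) (auto simp: power_int_add)
qed

lemma vge_mono: assumes "vge \<zeta> k x" "l \<le> k" shows "vge \<zeta> l x"
proof -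
  from assms obtain c x' where *: "hval \<zeta> x' c" "x = qlin \<zeta> powi k * x'" unfolding vge_def by blast
  have h: "hval \<zeta> (qlin \<zeta> ^ nat (k-l)) ((\<zeta>-\<zeta>) ^ nat (k-l))" unfolding qlin_def by blast
  have "qlin \<zeta> powi k = qlin \<zeta> powi l * qlin \<zeta> ^ nat (k-l)"
  proof -
    have "qlin \<zeta> powi k = qlin \<zeta> powi (l + int (nat (k-l)))" using assms(2) by simp
    thus ?thesis by (simp only: power_int_add[OF disjI1[OF qlin_nz]] power_int_of_nat)
  qed
  thus ?thesis unfolding vge_def using * hval_mult[OF h *(1)] by (auto simp: mult.assoc)
qed

lemma vge_add: assumes "vge \<zeta> k x" "vge \<zeta> k y" shows "vge \<zeta> k (x + y)"
proof -
  from assms obtain c x' d y' where "hval \<zeta> x' c" "x = qlin \<zeta> powi k * x'" "hval \<zeta> y' d" "y = qlin \<zeta> powi k * y'"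
    unfolding vge_def by blast
  thus ?thesis unfolding vge_def
    by (intro exI[of _ "c+d"] exI[of _ "x'+y'"]) (auto simp: algebra_simps)
qed

lemma vge_0 [simp]: "vge \<zeta> k 0"
  unfolding vge_def by (intro exI[of _ 0]) auto

lemma vge_const: "vge \<zeta> 0 (qconst c)" by (intro vge_hval) auto

lemma vge_uminus: "vge \<zeta> k x \<Longrightarrow> vge \<zeta> k (- x)"
  using vge_mult[OF vge_const[of \<zeta> "-1"], of k x] by simp

lemma vge_diff: "vge \<zeta> k x \<Longrightarrow> vge \<zeta> k y \<Longrightarrow> vge \<zeta> k (x - y)"
  using vge_add[OF _ vge_uminus, of \<zeta> k x y] by simp

lemma vge_sum: "(\<And>i. i \<in> A \<Longrightarrow> vge \<zeta> k (f i)) \<Longrightarrow> vge \<zeta> k (sum f A)"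
  by (induction A rule: infinite_finite_induct) (auto intro: vge_add)

lemma vge_prod: "(\<And>i. i \<in> A \<Longrightarrow> vge \<zeta> (k i) (f i)) \<Longrightarrow> vge \<zeta> (sum k A) (prod f A)"
proof (induction A rule: infinite_finite_induct)
  case (insert x A)
  thus ?case by (auto intro!: vge_mult)
qed (use vge_const[of _ 1] in auto)

lemma vge_power: "vge \<zeta> k x \<Longrightarrow> vge \<zeta> (int n * k) (x ^ n)"
proof (induction n)
  case (Suc n)
  thus ?case using vge_mult[of \<zeta> k x "int n * k" "x^n"] by (simp add: algebra_simps)
qed (use vge_const[of _ 1] in auto)

text \<open>The link between values and orders: by the factor theorem, a numerator that vanishes at
  \<open>\<zeta>\<close> contains the factor \<open>q - \<zeta>\<close>.\<close>

lemma hval_0_iff_vge_1: "hval \<zeta> x 0 \<longleftrightarrow> vge \<zeta> 1 x"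
proof
  assume "hval \<zeta> x 0"
  then obtain N D where *: "poly D \<zeta> \<noteq> 0" "x = to_fract N / to_fract D" "poly N \<zeta> = 0"
    unfolding hval_def by auto
  then obtain N' where N': "N = [:-\<zeta>, 1:] * N'" by (auto simp: poly_eq_0_iff_dvd)
  have "hval \<zeta> (to_fract N' / to_fract D) (poly N' \<zeta> / poly D \<zeta>)" using * unfolding hval_def by blast
  moreover have "x = qlin \<zeta> powi 1 * (to_fract N' / to_fract D)"
    using * by (simp add: N' qlin_eq del: mult_pCons_left)
  ultimately show "vge \<zeta> 1 x" unfolding vge_def by blast
next
  assume "vge \<zeta> 1 x"
  then obtain c y where *: "hval \<zeta> y c" "x = qlin \<zeta> * y" unfolding vge_def by auto
  have "hval \<zeta> ((qX - qconst \<zeta>) * y) ((\<zeta> - \<zeta>) * c)" using * by blast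
  thus "hval \<zeta> x 0" using * by (simp add: qlin_def)
qed

lemma vge_eq: "vge \<zeta> k x \<Longrightarrow> k = l \<Longrightarrow> vge \<zeta> l x" by simp

text \<open>The zero is simple: the cofactor \<open>S\<close> of \<open>q - \<zeta>\<close> has the
  nonzero value \<open>t \<zeta>^(t-1)\<close>, hence is a unit of the local ring. This gives the
  bound for the inverse too.\<close>

lemma vge_one_minus_power:
  assumes "t > 0" "\<zeta> ^ t = 1"
  shows "vge \<zeta> 1 (1 - qX ^ t)" "vge \<zeta> (-1) (inverse (1 - qX ^ t))"
proof -
  define S where "S = (\<Sum>i<t. qconst \<zeta> ^ (t - Suc i) * qX ^ i)"
  have "hval \<zeta> S (\<Sum>i<t. \<zeta> ^ (t - Suc i) * \<zeta> ^ i)" unfolding S_def by blast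
  also have "(\<Sum>i<t. \<zeta> ^ (t - Suc i) * \<zeta> ^ i) = (\<Sum>i<t. \<zeta> ^ (t - 1))"
    by (intro sum.cong) (auto simp flip: power_add)
  finally have S: "hval \<zeta> S (of_nat t * \<zeta> ^ (t - 1))" by simp
  have nz: "of_nat t * \<zeta> ^ (t - 1) \<noteq> 0" using assms by (cases "\<zeta> = 0") (auto simp: power_0_left)
  have eq: "1 - qX ^ t = - (qlin \<zeta> * S)"
  proof -
    have "qX ^ t - 1 = qlin \<zeta> * S"
      using power_diff_sumr2[of qX t "qconst \<zeta>"] assms(2)
      by (simp add: S_def qlin_def flip: qconst_power)
    thus ?thesis by (simp add: algebra_simps)
  qed
  show "vge \<zeta> 1 (1 - qX ^ t)" unfolding eq vge_def using hval_uminus[OF S]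
    by (intro exI conjI) (auto simp: algebra_simps)
  show "vge \<zeta> (-1) (inverse (1 - qX ^ t))" unfolding eq vge_def
    by (intro exI conjI, rule hval_uminus[OF hval_inverse[OF S nz]]) (simp add: power_int_minus field_simps)
qed

lemma qX_power_neq_1: "i > 0 \<Longrightarrow> qX ^ i \<noteq> 1"
proof
  assume "i > 0" "qX ^ i = 1"
  have "hval 0 (qX ^ i) (0 ^ i)" by blast
  hence "hval 0 1 0" using \<open>i > 0\<close> \<open>qX ^ i = 1\<close> by (simp add: power_0_left)
  with hval_unique[OF hval_1 this] show False by simp
qed

lemma qX_nz [simp]: "qX \<noteq> 0" by (simp add: qX_def)

section \<open>From orders of vanishing to congruences\<close>

lemma coprime_linear_polys:
  assumes "a \<noteq> b" shows "coprime [:-a, 1:] [:-b, 1::'a::field_gcd:]"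
proof -
  have "coprime [:-a, 1:] p \<or> [:-a,1:] dvd p" for p
    by (metis prime_elem_imp_coprime prime_elem_linear_field_poly zero_neq_one)
  moreover have "\<not> [:-a, 1:] dvd [:-b, 1:]" using assms by (simp add: dvd_iff_poly_eq_0)
  ultimately show ?thesis by blast
qed

lemma coprime_linear_poly:
  assumes "poly p a \<noteq> 0" shows "coprime [:-a, 1:] (p :: 'a::field_gcd poly)"
  by (metis assms poly_eq_0_iff_dvd prime_elem_imp_coprime prime_elem_linear_field_poly zero_neq_one)

lemma prod_pairwise_coprime_dvd:
  fixes f :: "'b \<Rightarrow> 'a::semiring_gcd"
  assumes "finite A" "\<And>x. x \<in> A \<Longrightarrow> f x dvd c" "\<And>x y. x \<in> A \<Longrightarrow> y \<in> A \<Longrightarrow> x \<noteq> y \<Longrightarrow> coprime (f x) (f y)"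
  shows "prod f A dvd c"
  using assms
proof (induction A rule: finite_induct)
  case (insert x A)
  have "coprime (f x) (prod f A)" using insert by (intro prod_coprime_right) auto
  thus ?case using insert by (auto intro: divides_mult)
qed auto

text \<open>Over the complex numbers \<open>P\<close> splits into powers of pairwise coprime linear
  factors, so the congruence can be checked one root at a time. The difference is written in lowest
  terms; then a root of the numerator cannot be a root of the denominator.\<close>

lemma qcongI:
  assumes P: "P \<noteq> 0" and ord: "\<And>\<zeta>. poly P \<zeta> = 0 \<Longrightarrow> vge \<zeta> (int (order \<zeta> P)) (A - B)"
  shows "qcong A B P"
proof -
  define N D where "N = fst (quot_of_fract (A - B))" and "D = snd (quot_of_fract (A - B))"
  have D0: "D \<noteq> 0" and co: "coprime N D" and AB: "A - B = to_fract N / to_fract D"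
    unfolding N_def D_def by (auto simp: coprime_quot_of_fract simp flip: Fract_conv_to_fract)
  have key: "[:-\<zeta>, 1:] ^ order \<zeta> P dvd N \<and> poly D \<zeta> \<noteq> 0" if z: "poly P \<zeta> = 0" for \<zeta>
  proof -
    from ord[OF z] obtain c y where "hval \<zeta> y c" and y: "A - B = qlin \<zeta> ^ order \<zeta> P * y"
      unfolding vge_def by auto
    then obtain N' D' where D': "poly D' \<zeta> \<noteq> 0" and yeq: "y = to_fract N' / to_fract D'"
      unfolding hval_def by blast
    have "D' \<noteq> 0" using D' by auto
    hence "to_fract (N * D') = qlin \<zeta> ^ order \<zeta> P * to_fract (N' * D)"
      using y AB yeq D0 by (simp add: divide_simps mult_ac)
    also have "qlin \<zeta> ^ order \<zeta> P = to_fract ([:-\<zeta>, 1:] ^ order \<zeta> P)"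
    proof -
      have "to_fract p ^ n = to_fract (p ^ n)" for p :: "complex poly" and n by (induction n) auto
      thus ?thesis by (simp add: qlin_eq)
    qed
    finally have "N * D' = [:-\<zeta>, 1:] ^ order \<zeta> P * (N' * D)" by (simp flip: to_fract_mult)
    hence "[:-\<zeta>, 1:] ^ order \<zeta> P dvd N * D'" by (rule dvdI)
    moreover have "coprime ([:-\<zeta>, 1:] ^ order \<zeta> P) D'" using coprime_linear_poly[OF D'] by simp
    ultimately have d: "[:-\<zeta>, 1:] ^ order \<zeta> P dvd N" by (simp add: coprime_dvd_mult_left_iff)
    have "order \<zeta> P \<noteq> 0" using z P by (simp add: order_root)
    hence "[:-\<zeta>, 1:] dvd N" using d by (metis dvd_power dvd_trans neq0_conv)
    hence "poly D \<zeta> \<noteq> 0" using co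
      by (metis coprime_common_divisor is_unit_pCons_iff one_neq_zero poly_eq_0_iff_dvd pCons_eq_0_iff pCons_eq_iff)
    with d show ?thesis by simp
  qed
  have fin: "finite {z. poly P z = 0}" using P by (rule poly_roots_finite)
  define Q where "Q = (\<Prod>z | poly P z = 0. [:-z, 1:] ^ order z P)"
  have PQ: "P = smult (lead_coeff P) Q" unfolding Q_def by (simp add: complex_poly_decompose)
  have "Q dvd N" unfolding Q_def using fin key
    by (intro prod_pairwise_coprime_dvd) (auto intro: coprime_linear_polys)
  hence "P dvd N" by (subst PQ) (use P in \<open>simp add: smult_dvd_iff\<close>)
  have "coprime D Q" unfolding Q_def
  proof (intro prod_coprime_right)
    fix z assume "z \<in> {z. poly P z = 0}"
    thus "coprime D ([:-z, 1:] ^ order z P)" using coprime_linear_poly[of D z] key[of z] by (simp add: coprime_commute)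
  qed
  moreover have "P dvd Q" by (subst PQ) (use P in \<open>simp add: smult_dvd_iff\<close>)
  ultimately have "coprime D P" using coprime_divisors[OF dvd_refl] by blast
  with \<open>P dvd N\<close> show ?thesis unfolding qcong_def using D0 AB by blast
qed

section \<open>Summation over blocks at a root of unity\<close>

text \<open>The ratio of consecutive parametric terms, apart from the factors \<open>q^(k^2)\<close>
  and \<open>[6k+1]\<close>. At \<open>y = 0\<close> the quadratic factors are squares and the
  original summand is recovered.\<close>

definition qratio :: "'a::field \<Rightarrow> 'a \<Rightarrow> nat \<Rightarrow> 'a" where
  "qratio q y j = (1 - q^(4*j+2)) * qquad q y (2*j+1) / ((1 - q^(4*j+4)) * qquad q y (4*j+4))"

definition psummand :: "'a::field \<Rightarrow> 'a \<Rightarrow> nat \<Rightarrow> 'a" where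
  "psummand q y k = q^(k^2) * (\<Sum>i<6*k+1. q^i) * (\<Prod>j<k. qratio q y j)"

lemma summand_eq_psummand: "summand Q k = psummand Q 0 k"
proof -
  have "qpoch Q (Q^2) k = (\<Prod>j<k. 1 - Q^(2*j+1))" "qpoch (Q^2) (Q^4) k = (\<Prod>j<k. 1 - Q^(4*j+2))"
    "qpoch (Q^4) (Q^4) k = (\<Prod>j<k. 1 - Q^(4*j+4))"
    by (simp_all add: qpoch_def add.commute flip: power_mult power_add power_Suc)
  thus ?thesis
    by (simp add: summand_def psummand_def qint_def qratio_def qquad_def prod_dividef prod.distrib prod_power_distrib
          power2_eq_square power3_eq_cube mult_ac)
qed

text \<open>The substitution \<open>a = q^e\<close>, for which \<open>a + 1/a - 2\<close> equals
  \<open>(1 - q^e)^2 / q^e\<close>.\<close>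

lemma qquad_at:
  fixes q :: "'a::field"
  assumes "q \<noteq> 0"
  shows "qquad q ((1 - q^e)^2 / q^e) i = (1 - q^e*q^i) * (q^e - q^i) / q^e"
  using assms unfolding qquad_def by (simp add: divide_simps) algebra

lemma geom: "(1 - q) * (\<Sum>i<n. q^i) = 1 - (q::'a::comm_ring_1)^n"
  using one_diff_power_eq[of q n] by simp

lemma psummand_at:
  fixes q :: "'a::field"
  assumes "q \<noteq> 0"
  shows "(1 - q) * psummand q ((1 - q^e)^2 / q^e) k = special_term q (q^e) k"
proof -
  have "a / q^e / (b * (c / q^e)) = a / (b * c)" for a b c using assms by simp
  hence h: "qratio q ((1 - q^e)^2 / q^e) j = (1-q^(4*j+2)) * ((1-q^e*q^(2*j+1)) * (q^e-q^(2*j+1)))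
       / ((1-q^(4*j+4)) * ((1-q^e*q^(4*j+4)) * (q^e-q^(4*j+4))))" for j
    unfolding qratio_def qquad_at[OF assms] by simp
  show ?thesis unfolding psummand_def special_term_def geom[of q "6*k+1", symmetric] h by (simp only: mult_ac)
qed

lemma psummand_sum_at:
  fixes q :: "'a::field"
  assumes q: "q \<noteq> 0" and nr: "\<And>i. i > 0 \<Longrightarrow> q^i \<noteq> 1" and "M < K"
  shows "(\<Sum>k<K. psummand q ((1 - q^(2*M+1))^2 / q^(2*M+1)) k) = (-1)^M * (\<Sum>i<2*M+1. q^i) / q^M"
proof -
  have q1: "1 - q \<noteq> 0" using nr[of 1] by simp
  have "(1 - q) * (q^M * (\<Sum>k<K. psummand q ((1 - q^(2*M+1))^2 / q^(2*M+1)) k)) = (1 - q) * ((-1)^M * (\<Sum>i<2*M+1. q^i))"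
  proof -
    have "(1 - q) * (q^M * (\<Sum>k<K. psummand q ((1 - q^(2*M+1))^2 / q^(2*M+1)) k)) = q^M * (\<Sum>k<K. special_term q (q^(2*M+1)) k)"
      unfolding psummand_at[OF q, symmetric] by (simp add: sum_distrib_left mult_ac)
    also have "\<dots> = (-1)^M * (1 - q^(2*M+1))" by (rule special_term_sum[OF assms])
    also have "\<dots> = (1 - q) * ((-1)^M * (\<Sum>i<2*M+1. q^i))" by (simp only: geom[symmetric] mult_ac)
    finally show ?thesis .
  qed
  hence "q^M * (\<Sum>k<K. psummand q ((1 - q^(2*M+1))^2 / q^(2*M+1)) k) = (-1)^M * (\<Sum>i<2*M+1. q^i)"
    using q1 by (simp only: mult_cancel_left) auto
  thus ?thesis using q by (simp add: eq_divide_eq mult_ac)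
qed

text \<open>For \<open>m > 0\<close> this means exact multiplicative order \<open>m\<close>. The
  form by divisibility lets every question whether \<open>1 - z^i\<close> vanishes be answered by
  \<open>m dvd i\<close>.\<close>

definition primroot :: "nat \<Rightarrow> complex \<Rightarrow> bool" where
  "primroot m z \<longleftrightarrow> (\<forall>i. z ^ i = 1 \<longleftrightarrow> m dvd i)"

text \<open>\<open>y = 0\<close> is good, and so are all but finitely many constants.\<close>

definition good :: "nat \<Rightarrow> complex \<Rightarrow> complex \<Rightarrow> bool" where
  "good m z y \<longleftrightarrow> (\<forall>i. \<not> m dvd i \<longrightarrow> qquad z y i \<noteq> 0)"

lemma odd_dvd_4: "odd (m::nat) \<Longrightarrow> m dvd 4*j+4 \<longleftrightarrow> m dvd j+1"
proof -
  assume "odd m"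
  hence "coprime m (2^2)" by (simp only: coprime_power_right_iff) simp
  moreover have "4*j+4 = 2^2*(j+1)" by simp
  ultimately show ?thesis by (metis coprime_dvd_mult_right_iff)
qed

lemma odd_dvd_2: "odd (m::nat) \<Longrightarrow> m dvd 4*j+2 \<longleftrightarrow> m dvd 2*j+1"
proof -
  assume "odd m"
  hence "coprime m 2" by simp
  moreover have "4*j+2 = 2*(2*j+1)" by simp
  ultimately show ?thesis by (metis coprime_dvd_mult_right_iff)
qed

lemma hval_qquad: "hval \<zeta> Q \<xi> \<Longrightarrow> hval \<zeta> y c \<Longrightarrow> hval \<zeta> (qquad Q y i) (qquad \<xi> c i)"
  unfolding qquad_def by blast

lemma qquad_qX_const_nz: "qquad qX (qconst y) (4*j+4) \<noteq> 0"
proof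
  assume *: "qquad qX (qconst y) (4*j+4) = 0"
  have "hval 0 (qquad qX (qconst y) (4*j+4)) (qquad 0 y (4*j+4))" by (intro hval_qquad hval_qX hval_const)
  hence "hval 0 0 1" by (simp only: *) (simp add: qquad_def power_0_left)
  from hval_unique[OF this hval_0] show False by simp
qed

text \<open>The deformed series is summed over the rational functions, where \<open>qX\<close> is
  not a root of unity, and evaluated at \<open>\<xi>\<close> only afterwards. Its terms specialize
  to \<open>1 - \<xi>\<close> times the parametric summands, while the closed form has the vanishing
  factor \<open>1 - q^(2M+1)\<close> over a denominator that is nonzero by
  \<open>good\<close>.\<close>

lemma psummand_sum_root_of_unity:
  assumes pr: "primroot (2*M+1) \<xi>" and M: "M \<ge> 1" and good: "good (2*M+1) \<xi> y"
  shows "(\<Sum>k\<le>M. psummand \<xi> y k) = 0"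
proof -
  let ?m = "2*M+1"
  have iff: "\<xi>^i = 1 \<longleftrightarrow> ?m dvd i" for i using pr by (simp add: primroot_def)
  have n0: "\<xi> \<noteq> 0" using iff[of ?m] by (auto simp: power_0_left)
  have n1: "1 - \<xi> \<noteq> 0" using iff[of 1] M by auto
  have d4: "\<not> ?m dvd 4*j+4" if "j < M" for j
  proof -
    have "\<not> ?m dvd j+1" using that by (auto dest!: dvd_imp_le)
    thus ?thesis using odd_dvd_4[of ?m j] by auto
  qed
  have d2: "\<not> ?m dvd 2*j+1" if "j < M" for j using that by (auto dest!: dvd_imp_le)
  \<comment> \<open>As \<open>\<xi>\<close> has order \<open>2M+1\<close>, the power
    \<open>\<xi>^(4*M)\<close> is the inverse of \<open>\<xi>^2\<close>. So the extra denominator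
    factors cancel against \<open>1 - \<xi>^(2*j+1)\<close>, and \<open>z - q^(4*j)\<close> turns
    into \<open>1 - \<xi>^(4*j+2)\<close> up to the factor \<open>\<xi>^2\<close>.\<close>
  have p1: "\<xi>^(4*M) * \<xi>^(2*j+3) = \<xi>^(2*j+1)" for j
  proof -
    have "4*M + (2*j+3) = ?m*2 + (2*j+1)" by simp
    hence "\<xi>^(4*M) * \<xi>^(2*j+3) = \<xi>^(?m*2) * \<xi>^(2*j+1)" by (simp only: flip: power_add)
    moreover have "\<xi>^(?m*2) = 1" unfolding iff by (rule dvd_triv_left)
    ultimately show ?thesis by (simp only: mult_1)
  qed
  have p2: "(\<xi>^(4*M) - \<xi>^(4*j)) * \<xi>^2 = 1 - \<xi>^(4*j+2)" for j
  proof -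
    have "4*M + 2 = ?m*2" by simp
    hence "\<xi>^(4*M) * \<xi>^2 = \<xi>^(?m*2)" by (simp only: flip: power_add)
    moreover have "\<xi>^(?m*2) = 1" unfolding iff by (rule dvd_triv_left)
    ultimately show ?thesis by (simp only: left_diff_distrib power_add)
  qed
  have hv: "hval \<xi> (deformed_term qX (qconst y) (qX^(4*M)) k) ((1 - \<xi>) * psummand \<xi> y k)" if k: "k < M+1" for k
  proof -
    have "hval \<xi> (deformed_term qX (qconst y) (qX^(4*M)) k) ((1 - \<xi>^(6*k+1)) * \<xi>^(k^2) * (\<Prod>j<k. (1-\<xi>^(2*j+1)) * qquad \<xi> y (2*j+1) * (\<xi>^(4*M)-\<xi>^(4*j)) * \<xi>^2
       / ((1-\<xi>^(4*j+4)) * qquad \<xi> y (4*j+4) * (1-\<xi>^(4*M)*\<xi>^(2*j+3)))))"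
      unfolding deformed_term_def
    proof (intro hval_mult hval_prod hval_divide)
      fix j assume "j \<in> {..<k}"
      hence j: "j < M" using k by simp
      show "(1-\<xi>^(4*j+4)) * qquad \<xi> y (4*j+4) * (1-\<xi>^(4*M)*\<xi>^(2*j+3)) \<noteq> 0"
        unfolding p1 using good d4[OF j] d2[OF j] iff[of "4*j+4"] iff[of "2*j+1"] by (simp add: good_def)
    qed (auto intro!: hval_qquad)
    also have "(\<Prod>j<k. (1-\<xi>^(2*j+1)) * qquad \<xi> y (2*j+1) * (\<xi>^(4*M)-\<xi>^(4*j)) * \<xi>^2
       / ((1-\<xi>^(4*j+4)) * qquad \<xi> y (4*j+4) * (1-\<xi>^(4*M)*\<xi>^(2*j+3)))) = (\<Prod>j<k. qratio \<xi> y j)"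
    proof (intro prod.cong refl)
      fix j assume "j \<in> {..<k}"
      hence j: "j < M" using k by simp
      have "1-\<xi>^(2*j+1) \<noteq> 0" using d2[OF j] iff[of "2*j+1"] by simp
      thus "(1-\<xi>^(2*j+1)) * qquad \<xi> y (2*j+1) * (\<xi>^(4*M)-\<xi>^(4*j)) * \<xi>^2
       / ((1-\<xi>^(4*j+4)) * qquad \<xi> y (4*j+4) * (1-\<xi>^(4*M)*\<xi>^(2*j+3))) = qratio \<xi> y j"
        unfolding p1 mult.assoc[of _ _ "\<xi>^2"] p2 qratio_def by (simp del: power_Suc add: mult_ac)
    qed
    finally show ?thesis unfolding psummand_def geom[symmetric] by (simp only: mult_ac)
  qed
  have "hval \<xi> (\<Sum>k<M+1. deformed_term qX (qconst y) (qX^(4*M)) k) (\<Sum>k<M+1. (1 - \<xi>) * psummand \<xi> y k)"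
    by (intro hval_sum hv) simp
  also have "(\<Sum>k<M+1. deformed_term qX (qconst y) (qX^(4*M)) k) = (\<Prod>j\<le>2*M. 1 - qX^(2*j+1)) / (\<Prod>j<M. qquad qX (qconst y) (4*j+4))"
    by (rule deformed_term_sum) (auto simp: qX_power_neq_1 qquad_qX_const_nz)
  finally have 1: "hval \<xi> ((\<Prod>j\<le>2*M. 1 - qX^(2*j+1)) / (\<Prod>j<M. qquad qX (qconst y) (4*j+4))) (\<Sum>k<M+1. (1 - \<xi>) * psummand \<xi> y k)" .
  have "hval \<xi> ((\<Prod>j\<le>2*M. 1 - qX^(2*j+1)) / (\<Prod>j<M. qquad qX (qconst y) (4*j+4)))
     ((\<Prod>j\<le>2*M. 1 - \<xi>^(2*j+1)) / (\<Prod>j<M. qquad \<xi> y (4*j+4)))"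
  proof (intro hval_divide hval_prod)
    show "(\<Prod>j<M. qquad \<xi> y (4*j+4)) \<noteq> 0" using good d4 by (auto simp: good_def)
  qed (auto intro!: hval_qquad)
  moreover have "(\<Prod>j\<le>2*M. 1 - \<xi>^(2*j+1)) = 0"
    using iff[of ?m] by (intro prod_zero bexI[of _ M]) auto
  ultimately have "(\<Sum>k<M+1. (1 - \<xi>) * psummand \<xi> y k) = 0" using hval_unique[OF 1] by simp
  thus ?thesis using n1 by (simp add: lessThan_Suc_atMost flip: sum_distrib_left)
qed

text \<open>For \<open>m = 2M+1\<close> the map from \<open>j\<close> to \<open>j - M\<close> sends
  poles to zeros, because \<open>2(j-M)+1 = 2(j+1) - m\<close>. Hence in every partial product of
  the ratios the zeros are at least as many as the poles.\<close>

lemma card_multiples_le: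
  fixes m k :: nat
  assumes "odd m"
  shows "(\<Sum>j<k. of_bool (m dvd j+1)) \<le> (\<Sum>j<k. of_bool (m dvd 2*j+1) :: int)"
proof -
  obtain M where M: "m = 2*M+1" using assms oddE by blast
  have "card {j\<in>{..<k}. m dvd j+1} \<le> card {j\<in>{..<k}. m dvd 2*j+1}"
  proof (rule card_inj_on_le[where f = "\<lambda>j. j - M"])
    have *: "M \<le> j" if "m dvd j+1" for j using dvd_imp_le[OF that] M by simp
    show "inj_on (\<lambda>j. j - M) {j\<in>{..<k}. m dvd j+1}"
      by (rule inj_onI) (use * in \<open>auto simp: eq_diff_iff\<close>)
    show "(\<lambda>j. j - M) ` {j\<in>{..<k}. m dvd j+1} \<subseteq> {j\<in>{..<k}. m dvd 2*j+1}"
    proof safe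
      fix j assume j: "j < k" "m dvd j+1"
      show "j - M < k" using j by simp
      have "2*(j-M)+1 = 2*(j+1) - m" using *[OF j(2)] M by simp
      thus "m dvd 2*(j-M)+1" using j(2) by (simp only:) (intro dvd_diff_nat dvd_mult dvd_refl)
    qed
  qed auto
  thus ?thesis by (simp add: sum_of_bool_eq Int_def)
qed

lemma primroot_qpower:
  assumes "primroot m (\<zeta>^s)" "s > 0" "m dvd i" "i > 0"
  shows "vge \<zeta> 1 (1 - (qX^s)^i)" "vge \<zeta> (-1) (inverse (1 - (qX^s)^i))"
proof -
  have "(\<zeta>^s)^i = 1" using assms by (simp add: primroot_def)
  hence "\<zeta>^(s*i) = 1" by (simp add: power_mult)
  thus "vge \<zeta> 1 (1 - (qX^s)^i)" "vge \<zeta> (-1) (inverse (1 - (qX^s)^i))"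
    using vge_one_minus_power[of "s*i" \<zeta>] assms by (simp_all add: power_mult)
qed

text \<open>\<open>1 - q^(4j+2)\<close> gives a simple zero and \<open>1 - q^(4j+4)\<close> a simple
  pole when \<open>m\<close> divides the exponent. At \<open>y = 0\<close> the quadratic factors are
  squares and add two more of each; at a nonzero good constant they give no pole, which accounts for
  the multiplicities 3 and 1.\<close>

lemma vge_qratio:
  assumes pr: "primroot m (\<zeta>^s)" and s: "s > 0" and m: "odd m" and good: "good m (\<zeta>^s) y"
  shows "vge \<zeta> ((if y = 0 then 3 else 1) * (of_bool (m dvd 2*j+1) - of_bool (m dvd j+1))) (qratio (qX^s) (qconst y) j)"
proof -
  let ?Q = "qX^s" and ?x = "\<zeta>^s"
  have hQ: "hval \<zeta> ?Q ?x" by blast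
  have hY: "hval \<zeta> (qquad ?Q (qconst y) i) (qquad ?x y i)" for i by (intro hval_qquad hQ) blast
  have iff: "?x^i = 1 \<longleftrightarrow> m dvd i" for i using pr by (simp add: primroot_def)
  have a: "vge \<zeta> (of_bool (m dvd 2*j+1)) (1 - ?Q^(4*j+2))"
  proof (cases "m dvd 2*j+1")
    case True
    thus ?thesis using primroot_qpower(1)[OF pr s, of "4*j+2"] odd_dvd_2[OF m, of j] by simp
  next
    case False
    have "hval \<zeta> (1 - ?Q^(4*j+2)) (1 - ?x^(4*j+2))" using hQ by blast
    thus ?thesis using False by (simp only: of_bool_eq vge_hval)
  qed
  have c: "vge \<zeta> (- of_bool (m dvd j+1)) (inverse (1 - ?Q^(4*j+4)))"
  proof (cases "m dvd j+1")
    case True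
    thus ?thesis using primroot_qpower(2)[OF pr s, of "4*j+4"] odd_dvd_4[OF m, of j] by simp
  next
    case False
    have "hval \<zeta> (1 - ?Q^(4*j+4)) (1 - ?x^(4*j+4))" using hQ by blast
    moreover have "1 - ?x^(4*j+4) \<noteq> 0" using iff[of "4*j+4"] False odd_dvd_4[OF m, of j] by simp
    ultimately have "vge \<zeta> 0 (inverse (1 - ?Q^(4*j+4)))" by (rule vge_hval[OF hval_inverse])
    thus ?thesis using False by simp
  qed
  have b: "vge \<zeta> ((if y = 0 then 2 else 0) * of_bool (m dvd 2*j+1)) (qquad ?Q (qconst y) (2*j+1))"
  proof (cases "y = 0 \<and> m dvd 2*j+1")
    case True
    hence "vge \<zeta> (int 2 * 1) ((1 - ?Q^(2*j+1))^2)"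
      by (intro vge_power primroot_qpower(1)[OF pr s]) auto
    thus ?thesis using True by (simp add: qquad_def)
  next
    case False
    thus ?thesis using vge_hval[OF hY] by auto
  qed
  have d: "vge \<zeta> ((if y = 0 then 2 else 0) * - of_bool (m dvd j+1)) (inverse (qquad ?Q (qconst y) (4*j+4)))"
  proof (cases "y = 0 \<and> m dvd j+1")
    case True
    hence "vge \<zeta> (int 2 * -1) ((inverse (1 - ?Q^(4*j+4)))^2)"
      using odd_dvd_4[OF m, of j] by (intro vge_power primroot_qpower(2)[OF pr s]) auto
    thus ?thesis using True by (simp add: qquad_def power_inverse)
  next
    case False
    \<comment> \<open>For \<open>m dvd j+1\<close> the value is \<open>-y\<close>, and
      \<open>y = 0\<close> is excluded in this case; for other \<open>j\<close> it is nonzero by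
      \<open>good\<close>.\<close>
    have "qquad ?x y (4*j+4) \<noteq> 0"
    proof (cases "m dvd j+1")
      case True
      hence "?x^(4*j+4) = 1" using iff odd_dvd_4[OF m, of j] by blast
      thus ?thesis using False True by (simp only: qquad_def) simp
    next
      case False
      thus ?thesis using good odd_dvd_4[OF m, of j] unfolding good_def by blast
    qed
    hence "vge \<zeta> 0 (inverse (qquad ?Q (qconst y) (4*j+4)))" by (rule vge_hval[OF hval_inverse[OF hY]])
    thus ?thesis using False by auto
  qed
  have "qratio ?Q (qconst y) j = (1 - ?Q^(4*j+2)) * qquad ?Q (qconst y) (2*j+1) * (inverse (1 - ?Q^(4*j+4)) * inverse (qquad ?Q (qconst y) (4*j+4)))"
    unfolding qratio_def divide_inverse inverse_mult_distrib ..
  also have "vge \<zeta> ((of_bool (m dvd 2*j+1) + (if y = 0 then 2 else 0) * of_bool (m dvd 2*j+1)) + (- of_bool (m dvd j+1) +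
     (if y = 0 then 2 else 0) * - of_bool (m dvd j+1))) \<dots>"
    by (intro vge_mult a b c d)
  finally show ?thesis by (rule vge_eq) simp
qed

text \<open>Single ratios may have poles; \<open>card_multiples_le\<close> says that earlier zeros
  compensate for them.\<close>

lemma qratio_prod_integral:
  assumes pr: "primroot m (\<zeta>^s)" and s: "s > 0" and m: "odd m" and good: "good m (\<zeta>^s) y"
  shows "vge \<zeta> 0 (\<Prod>j<k. qratio (qX^s) (qconst y) j)"
proof -
  have "vge \<zeta> (\<Sum>j<k. (if y = 0 then 3 else 1) * (of_bool (m dvd 2*j+1) - of_bool (m dvd j+1))) (\<Prod>j<k. qratio (qX^s) (qconst y) j)"
    by (intro vge_prod vge_qratio assms)
  moreover have "(\<Sum>j<k. (if y = 0 then 3 else 1) * (of_bool (m dvd 2*j+1) - of_bool (m dvd j+1) :: int)) \<ge> 0"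
    using card_multiples_le[OF m, of k] by (simp add: sum_subtractf flip: sum_distrib_left)
  ultimately show ?thesis by (rule vge_mono)
qed

lemma psummand_integral:
  assumes pr: "primroot m (\<zeta>^s)" and s: "s > 0" and m: "odd m" and good: "good m (\<zeta>^s) y"
  shows "vge \<zeta> 0 (psummand (qX^s) (qconst y) k)"
proof -
  have "vge \<zeta> 0 ((qX^s)^(k^2) * (\<Sum>i<6*k+1. (qX^s)^i))"
    by (rule vge_hval) blast
  from vge_mult[OF this qratio_prod_integral[OF assms, of k]] show ?thesis by (simp add: psummand_def)
qed

lemma sum_lessThan_add: "(\<Sum>k<a+b::nat. f k) = (\<Sum>k<a. f k) + (\<Sum>k<b. f (a+k) :: 'a::comm_monoid_add)"
  by (induction b) (auto simp: add_ac)

lemma prod_lessThan_add: "(\<Prod>k<a+b::nat. f k) = (\<Prod>k<a. f k) * (\<Prod>k<b. f (a+k) :: 'a::comm_monoid_mult)"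
  by (induction b) (auto simp: mult_ac)

text \<open>At \<open>\<zeta>\<close> powers of \<open>q^s\<close> depend only on the exponent
  modulo \<open>m\<close>, so a term of block \<open>l\<close> is a term of the first block times
  \<open>c\<close>. The product over earlier blocks is evaluated as a whole, since its single
  factors may have poles; the remaining ratios have index below \<open>k < m\<close> within the
  block and are regular.\<close>

lemma psummand_hval_block:
  assumes pr: "primroot m (\<zeta>^s)" and s: "s > 0" and m: "odd m" "m > 1" and good: "good m (\<zeta>^s) y" and k: "k < m"
    and c: "hval \<zeta> (\<Prod>j<l*m. qratio (qX^s) (qconst y) j) c"
  shows "hval \<zeta> (psummand (qX^s) (qconst y) (l*m+k)) (c * psummand (\<zeta>^s) y k)"
proof -
  let ?Q = "qX^s" and ?x = "\<zeta>^s"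
  have hQ: "hval \<zeta> ?Q ?x" by blast
  have iff: "?x^i = 1 \<longleftrightarrow> m dvd i" for i using pr by (simp add: primroot_def)
  have per: "?x^(l*m*a+i) = ?x^i" for a i
  proof -
    have "?x^(l*m*a) = 1" unfolding iff by simp
    thus ?thesis by (simp add: power_add)
  qed
  have n1: "1 - ?x \<noteq> 0" using iff[of 1] m by auto
  have "hval \<zeta> (qratio ?Q (qconst y) (l*m+j)) (qratio ?x y j)" if j: "j < k" for j
  proof -
    have "\<not> m dvd j+1" using j k by (auto dest!: dvd_imp_le)
    hence d: "\<not> m dvd 4*j+4" using odd_dvd_4[OF m(1)] by blast
    have e: "4*(l*m+j)+2 = l*m*4+(4*j+2)" "4*(l*m+j)+4 = l*m*4+(4*j+4)" "2*(l*m+j)+1 = l*m*2+(2*j+1)" by simp_all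
    have Yp: "qquad ?x y (l*m*a+i) = qquad ?x y i" for a i unfolding qquad_def per ..
    have "hval \<zeta> (qratio ?Q (qconst y) (l*m+j)) (qratio ?x y (l*m+j))"
      unfolding qratio_def
    proof (intro hval_divide hval_mult hval_qquad hQ hval_diff hval_power hval_1 hval_const)
      show "(1 - ?x^(4*(l*m+j)+4)) * qquad ?x y (4*(l*m+j)+4) \<noteq> 0"
        unfolding e per Yp using d iff[of "4*j+4"] good by (simp add: good_def)
    qed
    also have "qratio ?x y (l*m+j) = qratio ?x y j" unfolding qratio_def e per Yp ..
    finally show ?thesis .
  qed
  hence P: "hval \<zeta> (\<Prod>j<l*m+k. qratio ?Q (qconst y) j) (c * (\<Prod>j<k. qratio ?x y j))"
    unfolding prod_lessThan_add using c by (intro hval_mult hval_prod) auto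
  have "hval \<zeta> (psummand ?Q (qconst y) (l*m+k)) (?x^((l*m+k)^2) * (\<Sum>i<6*(l*m+k)+1. ?x^i) * (c * (\<Prod>j<k. qratio ?x y j)))"
    unfolding psummand_def by (intro hval_mult hval_power hval_sum hQ P)
  also have "(l*m+k)^2 = l*m*(l*m+2*k)+k^2" by (simp add: power2_eq_square algebra_simps)
  also have "(\<Sum>i<6*(l*m+k)+1. ?x^i) = (\<Sum>i<6*k+1. ?x^i)"
  proof -
    have e: "6*(l*m+k)+1 = l*m*6 + (6*k+1)" by simp
    have "(1 - ?x) * (\<Sum>i<6*(l*m+k)+1. ?x^i) = (1 - ?x) * (\<Sum>i<6*k+1. ?x^i)"
      unfolding geom e per ..
    thus ?thesis using n1 by (simp only: mult_cancel_left) auto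
  qed
  finally show ?thesis unfolding per psummand_def by (simp only: mult_ac)
qed

lemma psummand_tail_0:
  assumes "primroot (2*M+1) \<xi>" "M < k"
  shows "psummand \<xi> y k = 0"
proof -
  have "\<xi>^(2*(2*M+1)) = 1"
    by (rule assms(1)[unfolded primroot_def, rule_format, THEN iffD2, OF dvd_triv_right])
  moreover have "2*(2*M+1) = 4*M+2" by simp
  ultimately have "qratio \<xi> y M = 0" by (simp only: qratio_def) simp
  thus ?thesis unfolding psummand_def using assms(2) by auto
qed

text \<open>Each block has the value \<open>c\<close> times the sum over the first block, which is
  zero. The terms with \<open>M < k < m\<close> vanish at \<open>\<zeta>\<close>, so a last block
  cut off after \<open>M+1\<close> terms has value zero as well; this is the case of the half-length
  sums.\<close>

lemma psummand_sum_vge_1: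
  assumes pr: "primroot (2*M+1) (\<zeta>^s)" and s: "s > 0" and M: "M \<ge> 1" and good: "good (2*M+1) (\<zeta>^s) y"
  shows "vge \<zeta> 1 (\<Sum>k<l*(2*M+1). psummand (qX^s) (qconst y) k)"
    and "vge \<zeta> 1 (\<Sum>k<l*(2*M+1)+(M+1). psummand (qX^s) (qconst y) k)"
proof -
  let ?m = "2*M+1"
  have m: "odd ?m" "?m > 1" using M by auto
  have block: "vge \<zeta> 1 (\<Sum>k<b. psummand (qX^s) (qconst y) (l*?m+k))" if b: "M < b" "b \<le> ?m" for b l
  proof -
    obtain c where c: "hval \<zeta> (\<Prod>j<l*?m. qratio (qX^s) (qconst y) j) c"
      using qratio_prod_integral[OF pr s m(1) good] vge_0_iff by blast
    have "hval \<zeta> (\<Sum>k<b. psummand (qX^s) (qconst y) (l*?m+k)) (\<Sum>k<b. c * psummand (\<zeta>^s) y k)"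
      using b by (intro hval_sum psummand_hval_block[OF pr s m good _ c]) auto
    also have "(\<Sum>k<b. c * psummand (\<zeta>^s) y k) = (\<Sum>k\<le>M. c * psummand (\<zeta>^s) y k)"
      using b psummand_tail_0[OF pr] by (intro sum.mono_neutral_right) auto
    also have "\<dots> = 0" using psummand_sum_root_of_unity[OF pr M good] by (simp flip: sum_distrib_left)
    finally show ?thesis by (simp add: hval_0_iff_vge_1)
  qed
  show *: "vge \<zeta> 1 (\<Sum>k<l*?m. psummand (qX^s) (qconst y) k)" for l
  proof (induction l)
    case (Suc l)
    have "Suc l * ?m = l * ?m + ?m" by simp
    thus ?case using vge_add[OF Suc block[of ?m l]] by (simp only: sum_lessThan_add)
  qed auto
  show "vge \<zeta> 1 (\<Sum>k<l*?m+(M+1). psummand (qX^s) (qconst y) k)"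
    by (subst sum_lessThan_add, rule vge_add[OF * block]) (use M in auto)
qed

section \<open>Polynomials in the parameter\<close>

definition coeffs_vge :: "complex \<Rightarrow> int \<Rightarrow> ratfun poly \<Rightarrow> bool" where
  "coeffs_vge \<zeta> k p \<longleftrightarrow> (\<forall>i. vge \<zeta> k (coeff p i))"

lemma coeffs_vge_add: "coeffs_vge \<zeta> k p \<Longrightarrow> coeffs_vge \<zeta> k q \<Longrightarrow> coeffs_vge \<zeta> k (p + q)"
  by (auto simp: coeffs_vge_def intro: vge_add)

lemma coeffs_vge_diff: "coeffs_vge \<zeta> k p \<Longrightarrow> coeffs_vge \<zeta> k q \<Longrightarrow> coeffs_vge \<zeta> k (p - q)"
  by (auto simp: coeffs_vge_def intro: vge_diff)

lemma coeffs_vge_mult: "coeffs_vge \<zeta> k p \<Longrightarrow> coeffs_vge \<zeta> l q \<Longrightarrow> coeffs_vge \<zeta> (k + l) (p * q)"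
  by (auto simp: coeffs_vge_def coeff_mult intro: vge_sum vge_mult)

lemma coeffs_vge_const: "vge \<zeta> k a \<Longrightarrow> coeffs_vge \<zeta> k [:a:]"
  by (auto simp: coeffs_vge_def coeff_pCons split: nat.splits)

lemma coeffs_vge_linear: "vge \<zeta> k a \<Longrightarrow> vge \<zeta> k b \<Longrightarrow> coeffs_vge \<zeta> k [:a, b:]"
  by (auto simp: coeffs_vge_def coeff_pCons split: nat.splits)

lemma coeffs_vge_smult: "vge \<zeta> k a \<Longrightarrow> coeffs_vge \<zeta> l q \<Longrightarrow> coeffs_vge \<zeta> (k + l) (smult a q)"
  using coeffs_vge_mult[OF coeffs_vge_const] by simp

lemma coeffs_vge_sum: "(\<And>i. i \<in> A \<Longrightarrow> coeffs_vge \<zeta> k (f i)) \<Longrightarrow> coeffs_vge \<zeta> k (sum f A)"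
  by (auto simp: coeffs_vge_def coeff_sum intro: vge_sum)

lemma coeffs_vge_prod: "(\<And>i. i \<in> A \<Longrightarrow> coeffs_vge \<zeta> 0 (f i)) \<Longrightarrow> coeffs_vge \<zeta> 0 (prod f A)"
proof (induction A rule: infinite_finite_induct)
  case (insert x A)
  thus ?case using coeffs_vge_mult[of \<zeta> 0 "f x" 0 "prod f A"] by auto
qed (use coeffs_vge_const[OF vge_const[of _ 1]] in \<open>auto simp: one_pCons\<close>)

lemma vge_poly:
  assumes "coeffs_vge \<zeta> k p" "vge \<zeta> 0 x" shows "vge \<zeta> k (poly p x)"
proof -
  have "vge \<zeta> k (coeff p i * x ^ i)" for i
    using vge_mult[of \<zeta> k "coeff p i" "int i * 0"] assms vge_power[of \<zeta> 0 x i] by (auto simp: coeffs_vge_def)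
  thus ?thesis unfolding poly_altdef by (intro vge_sum)
qed

text \<open>The divisor is monic with \<open>c\<close> regular at \<open>\<zeta>\<close>, so each
  coefficient of \<open>r\<close> is recovered from the product and from the next higher coefficient
  of \<open>r\<close>.\<close>

lemma coeffs_vge_div_linear:
  assumes "coeffs_vge \<zeta> k ([:-c, 1:] * r)" "vge \<zeta> 0 c"
  shows "coeffs_vge \<zeta> k r"
proof -
  \<comment> \<open>Descending induction on the index: \<open>n = 0\<close> covers the zero
    coefficients above the degree, and \<open>n = Suc (degree r)\<close> covers all of them.\<close>
  have "\<forall>i. degree r < i + n \<longrightarrow> vge \<zeta> k (coeff r i)" for n
  proof (induction n)
    case 0
    thus ?case by (auto simp: coeff_eq_0)
  next
    case (Suc n)
    show ?case
    proof (intro allI impI)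
      fix i assume "degree r < i + Suc n"
      hence "vge \<zeta> k (coeff r (Suc i))" using Suc by auto
      hence "vge \<zeta> k (c * coeff r (Suc i))" using vge_mult[OF assms(2), of k] by simp
      moreover have "vge \<zeta> k (coeff ([:-c, 1:] * r) (Suc i))" using assms(1) unfolding coeffs_vge_def by blast
      moreover have "coeff ([:-c, 1:] * r) (Suc i) = coeff r i - c * coeff r (Suc i)" by simp
      ultimately have "vge \<zeta> k ((coeff r i - c * coeff r (Suc i)) + c * coeff r (Suc i))"
        by (metis vge_add)
      thus "vge \<zeta> k (coeff r i)" by simp
    qed
  qed
  from this[of "Suc (degree r)"] show ?thesis by (auto simp: coeffs_vge_def)
qed

text \<open>The roots need only be distinct as rational functions; they may coincide at
  \<open>\<zeta>\<close>. Distinctness keeps the later roots as roots of each quotient, and dividing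
  by monic linear factors preserves the order bound.\<close>

lemma coeffs_vge_div_roots:
  assumes "finite E" "inj_on c E" "\<And>e. e \<in> E \<Longrightarrow> vge \<zeta> 0 (c e)" "\<And>e. e \<in> E \<Longrightarrow> poly L (c e) = 0"
    "coeffs_vge \<zeta> k L"
  shows "\<exists>R. coeffs_vge \<zeta> k R \<and> L = (\<Prod>e\<in>E. [:- c e, 1:]) * R"
  using assms
proof (induction E rule: finite_induct)
  case (insert e E)
  have "inj_on c E" using insert.prems by (auto simp: inj_on_def)
  with insert obtain R where R: "coeffs_vge \<zeta> k R" "L = (\<Prod>e\<in>E. [:- c e, 1:]) * R" by blast
  have "(\<Prod>e'\<in>E. c e - c e') \<noteq> 0" using insert by (auto simp: inj_on_def)
  moreover have "poly L (c e) = 0" using insert by auto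
  ultimately have "poly R (c e) = 0" unfolding R(2) by (simp add: poly_prod)
  then obtain R' where R': "R = [:-c e, 1:] * R'" by (auto simp: poly_eq_0_iff_dvd)
  have "coeffs_vge \<zeta> k ([:-c e, 1:] * R')" using R(1) unfolding R' .
  moreover have "vge \<zeta> 0 (c e)" using insert.prems(2) by blast
  ultimately have "coeffs_vge \<zeta> k R'" by (rule coeffs_vge_div_linear)
  have "L = (\<Prod>e\<in>insert e E. [:- c e, 1:]) * R'"
    unfolding R(2) R' prod.insert[OF insert.hyps] by (simp only: mult_ac)
  with \<open>coeffs_vge \<zeta> k R'\<close> show ?case by blast
qed auto

text \<open>A polynomial over the local ring of \<open>\<zeta>\<close> whose values at infinitely many constants lie in the
  maximal ideal has all its coefficients there: constants have unit differences.\<close>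

lemma coeffs_vge_1I:
  assumes "coeffs_vge \<zeta> 0 L" "infinite G" "\<And>y. y \<in> G \<Longrightarrow> vge \<zeta> 1 (poly L (qconst y))"
  shows "coeffs_vge \<zeta> 1 L"
  using assms
proof (induction "degree L" arbitrary: L G)
  case 0
  obtain a where a: "L = [:a:]" using 0(1) degree_0_id by metis
  obtain y where "y \<in> G" using 0(3) by (metis ex_in_conv finite.emptyI)
  hence "vge \<zeta> 1 a" using 0(4)[of y] a by simp
  thus ?case unfolding a by (rule coeffs_vge_const)
next
  case (Suc d)
  obtain y1 where y1: "y1 \<in> G" using Suc(4) by (metis ex_in_conv finite.emptyI)
  let ?c = "qconst y1"
  \<comment> \<open>\<open>R\<close> has degree one less, and at any other constant of
    \<open>G\<close> its value is a difference of two values of \<open>L\<close> divided by a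
    nonzero constant. So the induction hypothesis applies to \<open>R\<close> on
    \<open>G - {y1}\<close>.\<close>
  define R where "R = synthetic_div L ?c"
  define a where "a = poly L ?c"
  have L: "L = [:-?c, 1:] * R + [:a:]" unfolding R_def a_def by (rule synthetic_div_correct'[symmetric])
  have a1: "vge \<zeta> 1 a" unfolding a_def using Suc(5) y1 .
  have "coeffs_vge \<zeta> 0 (L - [:a:])" using Suc(3) vge_mono[OF a1, of 0] by (intro coeffs_vge_diff coeffs_vge_const) auto
  moreover have "L - [:a:] = [:-?c, 1:] * R" by (subst L) (rule add_diff_cancel)
  ultimately have R0: "coeffs_vge \<zeta> 0 R" using coeffs_vge_div_linear[OF _ vge_const[of _ y1]] by metis
  have "coeffs_vge \<zeta> 1 R"
  proof (rule Suc(1))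
    show "d = degree R" using Suc(2) by (simp add: R_def degree_synthetic_div)
    show "infinite (G - {y1})" using Suc(4) by simp
    fix y assume y: "y \<in> G - {y1}"
    have "poly L (qconst y) = qconst (y - y1) * poly R (qconst y) + a" by (subst L) (simp add: algebra_simps)
    hence "poly R (qconst y) = inverse (qconst (y - y1)) * (poly L (qconst y) - a)"
      using y by simp
    moreover have "vge \<zeta> 0 (inverse (qconst (y - y1)))"
      by (rule vge_hval[OF hval_inverse[OF hval_const]]) (use y in simp)
    ultimately show "vge \<zeta> 1 (poly R (qconst y))"
      using vge_mult[of \<zeta> 0 "inverse (qconst (y - y1))" 1 "poly L (qconst y) - a"] vge_diff[OF Suc(5)[of y] a1] y by (simp del: qconst_simps)
  qed (rule R0)
  moreover have "coeffs_vge \<zeta> 0 [:-?c, 1:]"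
    by (intro coeffs_vge_linear vge_uminus vge_const vge_hval[OF hval_1])
  ultimately have "coeffs_vge \<zeta> (0 + 1) ([:-?c, 1:] * R)" by (intro coeffs_vge_mult)
  hence "coeffs_vge \<zeta> 1 ([:-?c, 1:] * R)" by (simp only: add_0)
  thus ?case by (subst L) (intro coeffs_vge_add coeffs_vge_const a1)
qed

section \<open>The sums as polynomials in the parameter, cleared of denominators\<close>

lemma qquad_power: "qquad (q^s) y i = qquad q y (s*i)"
  by (simp add: qquad_def power_mult)

definition quad_poly :: "nat \<Rightarrow> ratfun poly" where
  "quad_poly i = [:(1 - qX^i)^2, - (qX^i):]"

lemma poly_quad_poly: "poly (quad_poly i) y = qquad qX y i"
  by (simp add: quad_poly_def qquad_def)

lemma coeffs_vge_quad_poly: "coeffs_vge \<zeta> 0 (quad_poly i)"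
proof -
  have "vge \<zeta> 0 ((1 - qX^i)^2)" "vge \<zeta> 0 (- (qX^i))" by (rule vge_hval, blast)+
  thus ?thesis unfolding quad_poly_def by (rule coeffs_vge_linear)
qed

text \<open>The part of the summand at base \<open>q^s\<close> that is free of
  \<open>y\<close>.\<close>

definition weight :: "nat \<Rightarrow> nat \<Rightarrow> ratfun" where
  "weight s k = (qX^s)^(k^2) * (\<Sum>i<6*k+1. (qX^s)^i) * (\<Prod>j<k. (1 - (qX^s)^(4*j+2)) / (1 - (qX^s)^(4*j+4)))"

lemma psummand_weight: "psummand (qX^s) y k = weight s k * ((\<Prod>j<k. qquad qX y (s*(2*j+1))) / (\<Prod>j<k. qquad qX y (s*(4*j+4))))"
  by (simp add: psummand_def weight_def qratio_def qquad_power prod_dividef prod.distrib)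

text \<open>Stronger than \<open>good\<close>: the exponents divisible by the order are included, so
  \<open>y = 0\<close> is excluded by \<open>i = 0\<close>. Every quadratic factor is then a unit at
  \<open>\<zeta>\<close>.\<close>

definition generic :: "complex \<Rightarrow> complex \<Rightarrow> bool" where
  "generic \<zeta> y \<longleftrightarrow> (\<forall>i. qquad \<zeta> y i \<noteq> 0)"

lemma generic_good: "generic \<zeta> y \<Longrightarrow> good m (\<zeta>^s) y"
  by (simp add: generic_def good_def qquad_power)

text \<open>\<open>qquad \<zeta> y i\<close> depends on \<open>i\<close> only modulo
  \<open>m\<close> and is linear in \<open>y\<close>, so at most \<open>m\<close> values of
  \<open>y\<close> are excluded.\<close>

lemma infinite_generic:
  assumes "primroot m \<zeta>" "m > 0"
  shows "infinite {y. generic \<zeta> y}"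
proof -
  have iff: "\<zeta>^i = 1 \<longleftrightarrow> m dvd i" for i using assms by (simp add: primroot_def)
  have n0: "\<zeta> \<noteq> 0" using iff[of m] assms(2) by (auto simp: power_0_left)
  define B where "B = (\<lambda>i. (1-\<zeta>^i)^2/\<zeta>^i) ` {..<m}"
  have "- {y. generic \<zeta> y} \<subseteq> B"
  proof
    fix y assume "y \<in> - {y. generic \<zeta> y}"
    then obtain i where i: "qquad \<zeta> y i = 0" by (auto simp: generic_def)
    have "\<zeta>^(i div m * m) = 1" unfolding iff by simp
    hence "\<zeta>^i = \<zeta>^(i mod m)" using power_add[of \<zeta> "i div m * m" "i mod m"] by simp
    hence "qquad \<zeta> y (i mod m) = 0" using i by (simp add: qquad_def)
    hence "y = (1-\<zeta>^(i mod m))^2/\<zeta>^(i mod m)" using n0 by (simp add: qquad_def field_simps)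
    thus "y \<in> B" unfolding B_def using assms(2) by auto
  qed
  hence "finite (- {y. generic \<zeta> y})" by (rule finite_subset) (simp add: B_def)
  thus ?thesis using infinite_UNIV_char_0 by (metis finite_compl)
qed

text \<open>At a generic \<open>y\<close> the weight differs from the parametric summand by a unit.\<close>

lemma weight_integral:
  assumes pr: "primroot m (\<zeta>^s)" and s: "s > 0" and m: "odd m" and y: "generic \<zeta> y"
  shows "vge \<zeta> 0 (weight s k)"
proof -
  let ?A = "\<Prod>j<k. qquad qX (qconst y) (s*(2*j+1))" and ?B = "\<Prod>j<k. qquad qX (qconst y) (s*(4*j+4))"
  have hA: "hval \<zeta> ?A (\<Prod>j<k. qquad \<zeta> y (s*(2*j+1)))" and hB: "hval \<zeta> ?B (\<Prod>j<k. qquad \<zeta> y (s*(4*j+4)))"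
    by (intro hval_prod hval_qquad hval_qX hval_const)+
  have nz: "(\<Prod>j<k. qquad \<zeta> y (s*(2*j+1))) \<noteq> 0" "(\<Prod>j<k. qquad \<zeta> y (s*(4*j+4))) \<noteq> 0"
    using y by (auto simp: generic_def)
  have A0: "?A \<noteq> 0" using hval_unique[OF hA] nz(1) hval_0 by metis
  have B0: "?B \<noteq> 0" using hval_unique[OF hB] nz(2) hval_0 by metis
  have "weight s k = psummand (qX^s) (qconst y) k * (?B / ?A)"
    unfolding psummand_weight using A0 B0 by simp
  moreover have "vge \<zeta> 0 (?B / ?A)" by (rule vge_hval[OF hval_divide[OF hB hA nz(1)]])
  ultimately show ?thesis
    using vge_mult[OF psummand_integral[OF pr s m generic_good[OF y]]] by fastforce
qed

definition denom_poly :: "nat \<Rightarrow> ratfun poly" where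
  "denom_poly M = (\<Prod>j<M. quad_poly (4*j+4))"

text \<open>The sum at base \<open>q^s\<close> multiplied by \<open>denom_poly M\<close>. For
  \<open>j' = s*(j+1)-1\<close> one has \<open>4*j'+4 = s*(4*j+4)\<close>, so for
  \<open>s*K \<le> M\<close> the denominators at base \<open>q^s\<close> are among the factors of
  \<open>denom_poly M\<close>; the set difference removes those that cancel. Thus the sums at
  \<open>q\<close> and at \<open>q^n\<close> share one denominator.\<close>

definition cleared_poly :: "nat \<Rightarrow> nat \<Rightarrow> nat \<Rightarrow> ratfun poly" where
  "cleared_poly M s K = (\<Sum>k\<le>K. smult (weight s k) ((\<Prod>j<k. quad_poly (s*(2*j+1))) *
      (\<Prod>j\<in>{..<M} - (\<lambda>j. s*(j+1)-1) ` {..<k}. quad_poly (4*j+4))))"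

lemma poly_cleared_poly:
  assumes s: "s > 0" "s * K \<le> M" and nz: "\<And>j. qquad qX y (4*j+4) \<noteq> 0"
  shows "poly (cleared_poly M s K) y = poly (denom_poly M) y * (\<Sum>k\<le>K. psummand (qX^s) y k)"
proof -
  have "poly (smult (weight s k) ((\<Prod>j<k. quad_poly (s*(2*j+1))) *
      (\<Prod>j\<in>{..<M} - (\<lambda>j. s*(j+1)-1) ` {..<k}. quad_poly (4*j+4)))) y = poly (denom_poly M) y * psummand (qX^s) y k" if k: "k \<le> K" for k
  proof -
    let ?f = "\<lambda>j. s*(j+1)-1"
    have sub: "?f ` {..<k} \<subseteq> {..<M}"
    proof safe
      fix j assume "j < k"
      hence "s*(j+1) \<le> s*K" by (intro mult_le_mono2) (use k in simp)
      thus "s*(j+1)-1 < M" using s by (metis (no_types) One_nat_def Suc_pred add_gr_0 le_less_trans less_Suc_eq_le mult_pos_pos not_less zero_less_one order.trans)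
    qed
    have e: "4 * ?f j + 4 = s*(4*j+4)" for j
    proof -
      have "s*(j+1) \<ge> 1" using s by simp
      hence "4 * ?f j + 4 = 4 * (s*(j+1))" by (metis add_mult_distrib2 le_add_diff_inverse2 mult.right_neutral)
      thus ?thesis by (simp add: algebra_simps)
    qed
    have inj: "inj_on ?f {..<k}"
    proof (rule inj_onI)
      fix i j assume "?f i = ?f j"
      hence "s*(4*i+4) = s*(4*j+4)" by (simp only: e[symmetric])
      thus "i = j" using s by simp
    qed
    have "(\<Prod>j<M. qquad qX y (4*j+4)) = (\<Prod>j\<in>{..<M} - ?f ` {..<k}. qquad qX y (4*j+4)) * (\<Prod>j\<in>?f ` {..<k}. qquad qX y (4*j+4))"
      by (rule prod.subset_diff[OF sub]) simp
    also have "(\<Prod>j\<in>?f ` {..<k}. qquad qX y (4*j+4)) = (\<Prod>j<k. qquad qX y (s*(4*j+4)))"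
      by (subst prod.reindex[OF inj]) (simp only: o_def e)
    finally have 1: "(\<Prod>j<M. qquad qX y (4*j+4)) = (\<Prod>j\<in>{..<M} - ?f ` {..<k}. qquad qX y (4*j+4)) * (\<Prod>j<k. qquad qX y (s*(4*j+4)))" .
    have "(\<Prod>j<k. qquad qX y (s*(4*j+4))) \<noteq> 0" using nz by (simp add: e[symmetric])
    thus ?thesis unfolding psummand_weight denom_poly_def poly_prod poly_quad_poly 1 poly_smult poly_mult by simp
  qed
  thus ?thesis unfolding cleared_poly_def poly_sum sum_distrib_left by (intro sum.cong) auto
qed

lemma coeffs_vge_cleared_poly:
  assumes "primroot m (\<zeta>^s)" "s > 0" "odd m" "generic \<zeta> y"
  shows "coeffs_vge \<zeta> 0 (cleared_poly M s K)"
proof -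
  have "coeffs_vge \<zeta> (0 + (0 + 0)) (smult (weight s k) ((\<Prod>j<k. quad_poly (s*(2*j+1))) *
      (\<Prod>j\<in>{..<M} - (\<lambda>j. s*(j+1)-1) ` {..<k}. quad_poly (4*j+4))))" for k
    by (intro coeffs_vge_smult coeffs_vge_mult coeffs_vge_prod coeffs_vge_quad_poly weight_integral[OF assms])
  thus ?thesis unfolding cleared_poly_def by (intro coeffs_vge_sum) auto
qed

text \<open>Both sums carry the same \<open>y\<close>. For odd \<open>n\<close> and
  \<open>a = q^((2j+1)n)\<close> the parameter is then an odd power of \<open>q\<close> and also of
  \<open>q^n\<close>, and both series terminate.\<close>

definition discrepancy :: "nat \<Rightarrow> nat \<Rightarrow> nat \<Rightarrow> ratfun \<Rightarrow> ratfun" where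
  "discrepancy n M1 M2 y = (\<Sum>k\<le>M1. psummand qX y k) - (- qX) powi ((1 - int n) div 2) * qint qX n * (\<Sum>k\<le>M2. psummand (qX ^ n) y k)"

lemma prefactor_eq:
  assumes "n = 2*h+1"
  shows "(- qX) powi ((1 - int n) div 2) * qint qX n = (-1)^h / qX^h * (\<Sum>i<n. qX^i)"
proof -
  have "(1 - int n) div 2 = - int h" using assms by simp
  hence "(- qX) powi ((1 - int n) div 2) = inverse ((- qX) ^ h)" by (simp add: power_int_minus)
  also have "\<dots> = (-1)^h / qX^h" by (subst power_minus) (simp add: divide_simps flip: power_mult_distrib)
  finally show ?thesis by (simp add: qint_def)
qed

text \<open>The exponent is \<open>2(jn+h)+1\<close> for base \<open>q\<close> and
  \<open>2j+1\<close> for base \<open>q^n\<close>; the bounds on \<open>j\<close> make both sums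
  reach their last nonzero terms. The closed forms agree because \<open>[n]\<close> times the
  \<open>q^n\<close>-integer of \<open>2j+1\<close> is \<open>[(2j+1)n]\<close>, and because
  \<open>n\<close> is odd in the sign.\<close>

lemma discrepancy_at:
  assumes n: "n = 2*h+1" and j: "j \<le> M2" "j*n+h \<le> M1"
  shows "discrepancy n M1 M2 ((1 - qX^((2*j+1)*n))^2 / qX^((2*j+1)*n)) = 0"
proof -
  let ?e = "(2*j+1)*n"
  have e1: "?e = 2*(j*n+h)+1" using n by (simp add: algebra_simps)
  have e2: "qX^?e = (qX^n)^(2*j+1)" by (simp only: power_mult[symmetric] mult.commute)
  have nr: "(qX^n)^i \<noteq> 1" if "i > 0" for i
    unfolding power_mult[symmetric] using that n by (intro qX_power_neq_1) simp
  have 1: "(\<Sum>k\<le>M1. psummand qX ((1 - qX^?e)^2 / qX^?e) k) = (-1)^(j*n+h) * (\<Sum>i<?e. qX^i) / qX^(j*n+h)"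
    unfolding e1 lessThan_Suc_atMost[symmetric] using j by (intro psummand_sum_at qX_power_neq_1) auto
  have 2: "(\<Sum>k\<le>M2. psummand (qX^n) ((1 - qX^?e)^2 / qX^?e) k) = (-1)^j * (\<Sum>i<2*j+1. (qX^n)^i) / (qX^n)^j"
    unfolding e2 lessThan_Suc_atMost[symmetric] using j nr by (intro psummand_sum_at) auto
  have 3: "(\<Sum>i<n. qX^i) * (\<Sum>i<2*j+1. (qX^n)^i) = (\<Sum>i<?e. qX^i)"
  proof -
    have "(1 - qX) * ((\<Sum>i<n. qX^i) * (\<Sum>i<2*j+1. (qX^n)^i)) = (1 - qX^n) * (\<Sum>i<2*j+1. (qX^n)^i)"
      by (simp only: mult.assoc[symmetric] geom)
    also have "\<dots> = (1 - qX) * (\<Sum>i<?e. qX^i)" by (simp only: geom e2)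
    finally show ?thesis using qX_power_neq_1[of 1] by (simp only: mult_cancel_left) auto
  qed
  have 4: "(-1)^(j*n+h) = ((-1)^h * (-1)^j :: ratfun)"
    using n by (simp add: power_add power_mult mult.commute[of j])
  have 5: "qX^(j*n+h) = qX^h * (qX^n)^j" by (simp add: power_add mult.commute flip: power_mult)
  show ?thesis unfolding discrepancy_def prefactor_eq[OF n] 1 2 4 5 3[symmetric] by simp
qed

lemma prefactor_integral:
  assumes "n = 2*h+1" "\<zeta> \<noteq> 0"
  shows "hval \<zeta> ((- qX) powi ((1 - int n) div 2) * qint qX n) ((-1)^h / \<zeta>^h * (\<Sum>i<n. \<zeta>^i))"
  unfolding prefactor_eq[OF assms(1)]
  by (intro hval_mult hval_divide hval_power hval_uminus hval_1 hval_qX hval_sum) (use assms(2) in auto)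

text \<open>The core of the argument. \<open>L\<close> is the discrepancy times
  \<open>denom_poly M1\<close>; \<open>van\<close> makes it divisible by \<open>q - \<zeta>\<close>,
  the values \<open>c j\<close> are roots of it, and \<open>cnt\<close> compares the zeros of the
  \<open>c j\<close> with those of the denominator at \<open>y = 0\<close>.\<close>

lemma discrepancy_vge_3:
  assumes n: "n = 2*h+1" and pr: "primroot m \<zeta>" and m: "odd m" and prn: "primroot m' (\<zeta>^n)" and m': "odd m'"
    and M: "M2 * n + h \<le> M1"
    and van: "\<And>y. generic \<zeta> y \<Longrightarrow> vge \<zeta> 1 (discrepancy n M1 M2 (qconst y))"
    and cnt: "(\<Sum>j\<le>M2. of_bool (m dvd (2*j+1)*n)) \<ge> (\<Sum>j<M1. of_bool (m dvd j+1)) + (1::int)"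
  shows "vge \<zeta> 3 (discrepancy n M1 M2 0)"
proof -
  have m0: "m > 0" using m by (auto intro: Nat.gr0I)
  have iff: "\<zeta>^i = 1 \<longleftrightarrow> m dvd i" for i using pr by (simp add: primroot_def)
  have n0: "\<zeta> \<noteq> 0" using iff[of m] m0 by (auto simp: power_0_left)
  have pr1: "primroot m (\<zeta>^1)" using pr by simp
  have ngt: "n > 0" using n by simp
  obtain y1 where y1: "generic \<zeta> y1" using infinite_generic[OF pr m0] by (metis ex_in_conv finite.emptyI mem_Collect_eq)
  define C where "C = (- qX) powi ((1 - int n) div 2) * qint qX n"
  define L where "L = cleared_poly M1 1 M1 - smult C (cleared_poly M1 n M2)"
  have M': "n * M2 \<le> M1" using M by (simp add: mult.commute)
  have polyL: "poly L y = poly (denom_poly M1) y * discrepancy n M1 M2 y" if "\<And>j. qquad qX y (4*j+4) \<noteq> 0" for y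
    unfolding L_def poly_diff poly_smult using poly_cleared_poly[of 1 M1 M1 y] poly_cleared_poly[OF ngt M', of y] that
    by (simp add: discrepancy_def C_def algebra_simps)
  have C: "vge \<zeta> 0 C" unfolding C_def by (rule vge_hval[OF prefactor_integral[OF n n0]])
  have "coeffs_vge \<zeta> 0 (smult C (cleared_poly M1 n M2))"
    using coeffs_vge_smult[OF C coeffs_vge_cleared_poly[OF prn ngt m' y1]] by simp
  hence L0: "coeffs_vge \<zeta> 0 L" unfolding L_def
    by (intro coeffs_vge_diff coeffs_vge_cleared_poly[OF pr1 _ m y1]) auto
  have L1: "coeffs_vge \<zeta> 1 L"
  proof (rule coeffs_vge_1I[OF L0 infinite_generic[OF pr m0]])
    fix y assume "y \<in> {y. generic \<zeta> y}"
    hence v: "vge \<zeta> 1 (discrepancy n M1 M2 (qconst y))" using van by simp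
    have "vge \<zeta> 0 (poly (denom_poly M1) (qconst y))"
      unfolding denom_poly_def by (intro vge_poly coeffs_vge_prod coeffs_vge_quad_poly vge_const)
    from vge_mult[OF this v] show "vge \<zeta> 1 (poly L (qconst y))"
      by (subst polyL) (auto simp: qquad_qX_const_nz)
  qed
  define c where "c = (\<lambda>j. (1 - qX^((2*j+1)*n))^2 / qX^((2*j+1)*n))"
  have hc: "hval \<zeta> (c j) ((1 - \<zeta>^((2*j+1)*n))^2 / \<zeta>^((2*j+1)*n))" for j
    unfolding c_def by (intro hval_divide hval_power hval_diff hval_1 hval_qX) (use n0 in auto)
  \<comment> \<open>As \<open>q\<close> is not a root of unity, only one exponent makes the
    quadratic factor vanish at \<open>c j\<close>. Hence \<open>c\<close> is injective, and, that
    exponent being odd, no denominator factor vanishes there.\<close>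
  have Yc: "qquad qX (c j) i = 0 \<longleftrightarrow> i = (2*j+1)*n" for i j
  proof -
    have "qX^((2*j+1)*n) * qX^i \<noteq> 1" using qX_power_neq_1[of "(2*j+1)*n+i"] ngt by (simp add: power_add)
    thus ?thesis unfolding c_def qquad_at[OF qX_nz]
      using power_eq_imp_eq_exponent[OF qX_nz qX_power_neq_1, of "(2*j+1)*n" i] by auto
  qed
  have inj: "inj_on c {..M2}"
  proof (rule inj_onI)
    fix i j assume "c i = c j"
    hence "(2*i+1)*n = (2*j+1)*n" using Yc[of i "(2*i+1)*n"] Yc[of j "(2*i+1)*n"] by simp
    thus "i = j" using ngt by simp
  qed
  have root: "poly L (c j) = 0" if "j \<in> {..M2}" for j
  proof -
    have "qquad qX (c j) (4*i+4) \<noteq> 0" for i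
    proof
      assume "qquad qX (c j) (4*i+4) = 0"
      hence "4*i+4 = (2*j+1)*n" using Yc by simp
      moreover have "odd ((2*j+1)*n)" using n by simp
      moreover have "even (4*i+4)" by simp
      ultimately show False by metis
    qed
    hence "poly L (c j) = poly (denom_poly M1) (c j) * discrepancy n M1 M2 (c j)" by (rule polyL)
    moreover have "j * n + h \<le> M1" using that M by (meson add_le_mono1 atMost_iff le_trans mult_le_mono1)
    ultimately show ?thesis using discrepancy_at[OF n, of j M2 M1] that by (simp add: c_def)
  qed
  \<comment> \<open>All \<open>M2+1\<close> roots are divided out without losing the factor
    \<open>q - \<zeta>\<close>.\<close>
  obtain R where R: "coeffs_vge \<zeta> 1 R" and LR: "L = (\<Prod>j\<in>{..M2}. [:- c j, 1:]) * R"
    using coeffs_vge_div_roots[OF _ inj _ root L1] vge_hval[OF hc] by auto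
  have D0: "poly (denom_poly M1) 0 \<noteq> 0" using qquad_qX_const_nz[of 0] by (auto simp: denom_poly_def poly_prod poly_quad_poly)
  have "discrepancy n M1 M2 0 = poly L 0 * inverse (poly (denom_poly M1) 0)"
    using polyL[of 0] qquad_qX_const_nz[of 0] D0 by simp
  also have "\<dots> = (\<Prod>j\<le>M2. - c j) * poly R 0 * (\<Prod>j<M1. inverse (qquad qX 0 (4*j+4)))"
  proof -
    have "(\<Prod>j<M1. inverse (qquad qX 0 (4*j+4))) = inverse (\<Prod>j<M1. qquad qX 0 (4*j+4))"
      by (rule prod_inversef[unfolded o_def])
    thus ?thesis by (simp add: LR poly_prod denom_poly_def poly_quad_poly del: mult_pCons_left)
  qed
  \<comment> \<open>Two zeros for each \<open>c j\<close> with \<open>m\<close> dividing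
    \<open>(2j+1)n\<close>, one from \<open>R\<close>, minus two for each \<open>j\<close> with
    \<open>m\<close> dividing \<open>j+1\<close>. By \<open>cnt\<close> the total is at least
    \<open>2 + 1\<close>.\<close>
  also have "vge \<zeta> ((\<Sum>j\<le>M2. 2 * of_bool (m dvd (2*j+1)*n)) + 1 + (\<Sum>j<M1. 2 * - of_bool (m dvd j+1))) \<dots>"
  proof (intro vge_mult vge_prod)
    show "vge \<zeta> 1 (poly R 0)" by (intro vge_poly R vge_0)
    fix j :: nat
    show "vge \<zeta> (2 * of_bool (m dvd (2*j+1)*n)) (- c j)"
    proof (cases "m dvd (2*j+1)*n")
      case True
      have "vge \<zeta> (int 2 * 1) ((1 - (qX^1)^((2*j+1)*n))^2)"
        using True ngt by (intro vge_power primroot_qpower(1)[OF pr1]) auto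
      moreover have "vge \<zeta> 0 (inverse (qX^((2*j+1)*n)))"
        by (rule vge_hval[OF hval_inverse[OF hval_power[OF hval_qX]]]) (use n0 in simp)
      ultimately have "vge \<zeta> (int 2 * 1 + 0) (c j)"
        unfolding c_def divide_inverse power_one_right by (rule vge_mult)
      thus ?thesis using True by (intro vge_uminus) simp
    next
      case False
      thus ?thesis using vge_uminus[OF vge_hval[OF hc]] by simp
    qed
    show "vge \<zeta> (2 * - of_bool (m dvd j+1)) (inverse (qquad qX 0 (4*j+4)))"
    proof (cases "m dvd j+1")
      case True
      hence "vge \<zeta> (int 2 * -1) ((inverse (1 - (qX^1)^(4*j+4)))^2)"
        using odd_dvd_4[OF m, of j] by (intro vge_power primroot_qpower(2)[OF pr1]) auto
      thus ?thesis using True by (simp add: qquad_def power_inverse)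
    next
      case False
      have "hval \<zeta> (qquad qX 0 (4*j+4)) (qquad \<zeta> 0 (4*j+4))" by (intro hval_qquad hval_qX hval_0)
      moreover have "qquad \<zeta> 0 (4*j+4) \<noteq> 0" using False iff[of "4*j+4"] odd_dvd_4[OF m, of j] by (simp add: qquad_def)
      ultimately have "vge \<zeta> 0 (inverse (qquad qX 0 (4*j+4)))" by (rule vge_hval[OF hval_inverse])
      thus ?thesis using False by simp
    qed
  qed
  finally show ?thesis
    by (rule vge_mono) (use cnt in \<open>simp add: sum_distrib_left[symmetric] sum_negf\<close>)
qed

section \<open>The modulus\<close>

lemma primroot_exists:
  assumes "\<zeta> ^ N = 1" "N > 0"
  obtains m where "m > 0" "primroot m \<zeta>"
proof -
  define m where "m = (LEAST i. i > 0 \<and> \<zeta>^i = 1)"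
  have m: "m > 0" "\<zeta>^m = 1" using LeastI[of "\<lambda>i. i > 0 \<and> \<zeta>^i = 1" N] assms by (auto simp: m_def)
  have "m dvd i" if "\<zeta>^i = 1" for i
  proof -
    have "\<zeta>^i = \<zeta>^(i div m * m) * \<zeta>^(i mod m)" by (simp flip: power_add)
    also have "\<zeta>^(i div m * m) = 1" using m by (simp add: power_mult mult.commute[of _ m])
    finally have "\<zeta>^(i mod m) = 1" using that by simp
    moreover have "i mod m < m" using m by simp
    ultimately have "i mod m = 0" using not_less_Least[of "i mod m" "\<lambda>i. i > 0 \<and> \<zeta>^i = 1"] by (auto simp: m_def)
    thus ?thesis by auto
  qed
  moreover have "\<zeta>^i = 1" if "m dvd i" for i using that m by (auto simp: power_mult elim!: dvdE)
  ultimately show ?thesis using that[of m] m by (auto simp: primroot_def)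
qed

text \<open>With \<open>N = m t\<close>, \<open>m = 2M+1\<close> and \<open>t = 2l+1\<close>, the
  full sum has \<open>t\<close> whole blocks, and the half sum has
  \<open>(N+1)/2 = l m + (M+1)\<close> terms: \<open>l\<close> blocks and a cut one.\<close>

lemma psummand_sum_vge_1':
  assumes pr: "primroot m (\<zeta>^s)" and s: "s > 0" and m: "m > 1" and good: "good m (\<zeta>^s) y"
    and N: "odd N" "m dvd N" and K: "K = N \<or> 2 * K = N + 1"
  shows "vge \<zeta> 1 (\<Sum>k<K. psummand (qX^s) (qconst y) k)"
proof -
  obtain t where t: "N = m * t" using N by auto
  have "odd m" "odd t" using N t by auto
  then obtain M l where M: "m = 2*M+1" and l: "t = 2*l+1" by (auto elim!: oddE)
  have M1: "M \<ge> 1" using m M by simp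
  from K show ?thesis
  proof
    assume "K = N"
    hence "K = t * (2*M+1)" using t M by simp
    thus ?thesis using psummand_sum_vge_1(1)[OF pr[unfolded M] s M1 good[unfolded M]] by simp
  next
    assume "2 * K = N + 1"
    hence "K = l*(2*M+1)+(M+1)" unfolding t M l by (simp add: algebra_simps)
    thus ?thesis using psummand_sum_vge_1(2)[OF pr[unfolded M] s M1 good[unfolded M]] by simp
  qed
qed

text \<open>The first sum vanishes at \<open>\<zeta>\<close> by its blocks. For the second, let
  \<open>m'\<close> be the order of \<open>\<zeta>^n\<close>: if \<open>m' > 1\<close> the blocks at
  base \<open>q^n\<close> vanish, and if \<open>m' = 1\<close> then \<open>\<zeta>^n = 1\<close>, so
  the factor \<open>[n]\<close> vanishes while the sum is regular.\<close>

lemma discrepancy_vge_1: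
  assumes n: "n = 2*h+1" and r: "r \<ge> 1"
    and shape: "M1 + 1 = n^r \<and> M2 + 1 = n^(r-1) \<or> 2*M1+1 = n^r \<and> 2*M2+1 = n^(r-1)"
    and pr: "primroot m \<zeta>" and m: "m > 1" "m dvd n^r" and prn: "primroot m' (\<zeta>^n)"
    and good: "good m \<zeta> y" "good m' (\<zeta>^n) y"
  shows "vge \<zeta> 1 (discrepancy n M1 M2 (qconst y))"
proof -
  have iff: "\<zeta>^i = 1 \<longleftrightarrow> m dvd i" for i using pr by (simp add: primroot_def)
  have iff': "(\<zeta>^n)^i = 1 \<longleftrightarrow> m' dvd i" for i using prn by (simp add: primroot_def)
  have ngt: "n > 0" and oddn: "odd (n^j)" for j using n by simp_all
  have n0: "\<zeta> \<noteq> 0" using iff[of m] m by (auto simp: power_0_left)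
  have nr: "n^r = n * n^(r-1)" using r by (cases r) auto
  have "(\<zeta>^n)^(n^(r-1)) = 1" using iff[of "n^r"] m unfolding nr by (simp add: power_mult)
  hence m'd: "m' dvd n^(r-1)" unfolding iff' .
  hence oddm': "odd m'" using oddn by (meson dvd_trans)
  have 1: "vge \<zeta> 1 (\<Sum>k\<le>M1. psummand qX (qconst y) k)"
    using psummand_sum_vge_1'[of m \<zeta> 1 y "n^r" "M1+1"] pr m good oddn shape by (auto simp: lessThan_Suc_atMost)
  let ?C = "(- qX) powi ((1 - int n) div 2) * qint qX n"
  have hC: "hval \<zeta> ?C ((-1)^h / \<zeta>^h * (\<Sum>i<n. \<zeta>^i))" by (rule prefactor_integral[OF n n0])
  have 2: "vge \<zeta> 1 (?C * (\<Sum>k\<le>M2. psummand (qX^n) (qconst y) k))"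
  proof (cases "m' = 1")
    case True
    hence "\<zeta>^n = 1" using iff'[of 1] by simp
    moreover have "\<zeta> \<noteq> 1" using iff[of 1] m by auto
    ultimately have "(\<Sum>i<n. \<zeta>^i) = 0" using geom[of \<zeta> n] by simp
    hence "vge \<zeta> 1 ?C" using hC hval_0_iff_vge_1 by simp
    moreover have "vge \<zeta> 0 (\<Sum>k\<le>M2. psummand (qX^n) (qconst y) k)"
      using psummand_integral[OF prn ngt oddm' good(2)] by (intro vge_sum)
    ultimately show ?thesis using vge_mult[of \<zeta> 1 ?C 0] by simp
  next
    case False
    moreover have "m' > 0" using oddm' by (auto intro: Nat.gr0I)
    ultimately have "m' > 1" by simp
    hence "vge \<zeta> 1 (\<Sum>k\<le>M2. psummand (qX^n) (qconst y) k)"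
      using psummand_sum_vge_1'[of m' \<zeta> n y "n^(r-1)" "M2+1"] prn ngt good oddn m'd shape by (auto simp: lessThan_Suc_atMost)
    thus ?thesis using vge_mult[OF vge_hval[OF hC], of 1] by simp
  qed
  show ?thesis unfolding discrepancy_def by (rule vge_diff[OF 1 2])
qed

text \<open>At most \<open>K\<close> of the numbers \<open>1, ..., M1\<close> are multiples of
  \<open>n^i\<close>. On the other side it suffices that \<open>p = n^(i-1)\<close> divides
  \<open>2j+1\<close>: the odd multiples \<open>p(2l+1)\<close> with \<open>l \<le> K\<close> supply
  \<open>K+1\<close> solutions, which \<open>bound\<close> keeps within
  \<open>j \<le> M2\<close>.\<close>

lemma count_le:
  fixes n r i M1 M2 :: nat
  assumes n: "n = 2*h+1" and i: "1 \<le> i" "i \<le> r"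
    and shape: "M1 + 1 = n^r \<and> M2 + 1 = n^(r-1) \<or> 2*M1+1 = n^r \<and> 2*M2+1 = n^(r-1)"
  shows "(\<Sum>j\<le>M2. of_bool (n^i dvd (2*j+1)*n)) \<ge> (\<Sum>j<M1. of_bool (n^i dvd j+1)) + (1::int)"
proof -
  define K where "K = M1 div n^i"
  define p u where "p = n^(i-1)" and "u = n^(r-i)"
  have n0: "n > 0" "p > 0" using n by (auto simp: p_def)
  have ni: "n^i = n*p" using i by (cases i) (auto simp: p_def)
  have nr: "n^r = n^i*u" using i by (simp add: u_def flip: power_add)
  have nr1: "n^(r-1) = p*u" using i by (simp add: u_def p_def flip: power_add)
  have "odd p" using n by (simp add: p_def)
  then obtain g where g: "p = 2*g+1" by (auto elim: oddE)
  have K1: "K * n^i \<le> M1" unfolding K_def by simp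
  have bound: "p*(2*K+1) \<le> 2*M2+1"
    using shape
  proof
    assume a: "M1 + 1 = n^r \<and> M2 + 1 = n^(r-1)"
    have "n^i * K < n^i * u" using K1 conjunct1[OF a] unfolding nr mult.commute[of K] by linarith
    hence "K + 1 \<le> u" by simp
    hence "p * (K + 1) \<le> p * u" by (rule mult_le_mono2)
    hence "p * K + p \<le> M2 + 1" using a nr1 by simp
    thus ?thesis using n0 by (simp add: algebra_simps)
  next
    assume a: "2*M1+1 = n^r \<and> 2*M2+1 = n^(r-1)"
    have "2 * (n^i * K) < n^i * u" using K1 conjunct1[OF a] unfolding nr mult.commute[of K] by linarith
    hence "n^i * (2*K) < n^i * u" by (simp only: mult.left_commute)
    hence "2*K + 1 \<le> u" by simp
    hence "p * (2*K + 1) \<le> p * u" by (rule mult_le_mono2)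
    thus ?thesis using a nr1 by simp
  qed
  have "card {j\<in>{..<M1}. n^i dvd j+1} \<le> card {..<K}"
  proof (rule surj_card_le)
    show "{j\<in>{..<M1}. n^i dvd j+1} \<subseteq> (\<lambda>l. n^i*(l+1)-1) ` {..<K}"
    proof safe
      fix j assume j: "j < M1" "n^i dvd j+1"
      then obtain c where c: "j+1 = n^i * c" by auto
      hence "c \<noteq> 0" by (intro notI) simp
      then obtain c' where c': "c = c' + 1" by (metis Suc_eq_plus1 not0_implies_Suc)
      have "c \<le> K" unfolding K_def using c j n0 by (simp add: less_eq_div_iff_mult_less_eq mult.commute)
      hence "c' \<in> {..<K}" using c' by simp
      moreover have "j = n^i*(c'+1)-1" using c c' by simp
      ultimately show "j \<in> (\<lambda>l. n^i*(l+1)-1) ` {..<K}" by blast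
    qed
  qed simp
  hence a: "card {j\<in>{..<M1}. n^i dvd j+1} \<le> K" by simp
  have "card {..K} \<le> card {j\<in>{..M2}. n^i dvd (2*j+1)*n}"
  \<comment> \<open>The image of \<open>l\<close> is the \<open>j\<close> with
    \<open>2j+1 = p(2l+1)\<close>, as \<open>p = 2g+1\<close>.\<close>
  proof (rule card_inj_on_le[where f = "\<lambda>l. g*(2*l+1)+l"])
    have less: "g*(2*x+1)+x < g*(2*y+1)+y" if "x < y" for x y :: nat
      using that by (intro add_le_less_mono mult_le_mono2) auto
    show "inj_on (\<lambda>l. g*(2*l+1)+l) {..K}"
    proof (rule inj_onI)
      fix x y assume "g*(2*x+1)+x = g*(2*y+1)+y"
      thus "x = y" using less[of x y] less[of y x] by (cases x y rule: linorder_cases) auto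
    qed
    have e: "2*(g*(2*l+1)+l)+1 = p*(2*l+1)" for l using g by (simp add: algebra_simps)
    show "(\<lambda>l. g*(2*l+1)+l) ` {..K} \<subseteq> {j\<in>{..M2}. n^i dvd (2*j+1)*n}"
    proof safe
      fix l assume l: "l \<le> K"
      have "p*(2*l+1) \<le> p*(2*K+1)" using l by (intro mult_le_mono2) simp
      hence "2*(g*(2*l+1)+l)+1 \<le> 2*M2+1" unfolding e using bound by (rule le_trans)
      moreover have "2*a + 1 \<le> 2*b + 1 \<Longrightarrow> a \<le> b" for a b :: nat by simp
      ultimately show "g*(2*l+1)+l \<le> M2" by blast
      show "n^i dvd (2*(g*(2*l+1)+l)+1)*n" unfolding e ni by simp
    qed
  qed simp
  hence "K + 1 \<le> card {j\<in>{..M2}. n^i dvd (2*j+1)*n}" by simp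
  with a show ?thesis by (simp add: sum_of_bool_eq Int_def)
qed

section \<open>Orders of the zeros of the modulus\<close>

lemma order_prod:
  assumes "finite A" "\<And>x. x \<in> A \<Longrightarrow> f x \<noteq> (0 :: complex poly)"
  shows "order z (prod f A) = (\<Sum>x\<in>A. order z (f x))"
  using assms
proof (induction A rule: finite_induct)
  case (insert x A)
  hence "f x * prod f A \<noteq> 0" by auto
  thus ?case using insert by (simp add: order_mult)
qed auto

lemma order_linear: "order z [:-a, 1:] = of_bool (z = (a::complex))"
  using order_power_n_n[of a 1] by (auto intro: order_0I)

lemma primroot_cis:
  assumes "m > 0"
  shows "primroot m (cis (2 * pi / real m))"
proof -
  let ?w = "cis (2 * pi / real m)"
  have w: "?w^i = cis (2 * pi * real i / real m)" for i
    by (simp add: DeMoivre mult_ac)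
  have wm: "?w^m = 1" unfolding w using assms by simp
  have inj: "inj_on (\<lambda>i. ?w^i) {..<m}"
    using bij_betw_imp_inj_on[OF bij_betw_roots_unity[OF assms]] unfolding w .
  have "m dvd i" if "?w^i = 1" for i
  proof -
    have "?w^i = ?w^(i div m * m) * ?w^(i mod m)" by (simp only: power_add[symmetric] div_mult_mod_eq)
    also have "?w^(i div m * m) = 1" by (simp only: mult.commute[of _ m] power_mult wm power_one)
    finally have "?w^(i mod m) = ?w^0" using that by simp
    hence "i mod m = 0" using inj assms unfolding inj_on_def by (metis lessThan_iff mod_less_divisor)
    thus ?thesis by auto
  qed
  moreover have "?w^i = 1" if "m dvd i" for i using that wm by (auto simp: power_mult elim!: dvdE)
  ultimately show ?thesis unfolding primroot_def by blast
qed

text \<open>The listed roots are powers \<open>w^k\<close> with \<open>k\<close> between 1 and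
  \<open>m\<close>, pairwise distinct and hence simple; an exponent coprime to \<open>m\<close>
  gives an element of exact order \<open>m\<close>.\<close>

lemma order_cyclotomic:
  assumes "m > 0"
  shows "cyclotomic m \<noteq> 0" "order z (cyclotomic m) \<le> (if primroot m z then 1 else 0)"
proof -
  let ?A = "{k. 1 \<le> k \<and> k \<le> m \<and> coprime k m}" and ?w = "cis (2 * pi / real m)"
  define f where "f = (\<lambda>k. cis (2 * pi * real k / real m))"
  have f: "f k = ?w^k" for k by (simp add: f_def DeMoivre mult_ac)
  have iff: "?w^i = 1 \<longleftrightarrow> m dvd i" for i using primroot_cis[OF assms] by (simp add: primroot_def)
  have fin: "finite ?A" by (rule finite_subset[of _ "{..m}"]) auto
  have c: "cyclotomic m = (\<Prod>k\<in>?A. [:- f k, 1:])" by (simp add: cyclotomic_def f_def)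
  show "cyclotomic m \<noteq> 0" unfolding c using fin by simp
  have o: "order z (cyclotomic m) = card {k\<in>?A. z = f k}"
    unfolding c using fin by (subst order_prod) (auto simp: order_linear sum_of_bool_eq Int_def)
  have inj: "k = l" if "k \<in> ?A" "l \<in> ?A" "f k = f l" "k \<le> l" for k l
  proof -
    have "?w^k * ?w^(l-k) = ?w^l" using that(4) by (simp flip: power_add)
    also have "\<dots> = ?w^k * 1" using that(3) by (simp add: f)
    finally have "?w^(l-k) = 1" by simp
    hence "m dvd l-k" by (simp flip: iff)
    moreover have "l - k < m" using that by auto
    ultimately show ?thesis using that dvd_imp_le[of m "l-k"] by fastforce
  qed
  have le1: "card {k\<in>?A. z = f k} \<le> 1"
  proof -
    have "k = l" if "k \<in> {k\<in>?A. z = f k}" "l \<in> {k\<in>?A. z = f k}" for k l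
    proof (cases "k \<le> l")
      case True
      thus ?thesis using that inj[of k l] by simp
    next
      case False
      thus ?thesis using that inj[of l k] by simp
    qed
    thus ?thesis using fin by (simp add: card_le_Suc0_iff_eq)
  qed
  show "order z (cyclotomic m) \<le> (if primroot m z then 1 else 0)"
  proof (cases "{k\<in>?A. z = f k} = {}")
    case True
    thus ?thesis unfolding o by (simp only: card.empty zero_le)
  next
    case False
    then obtain k where k: "coprime k m" "z = ?w^k" using f by auto
    have "primroot m z" unfolding primroot_def k(2) power_mult[symmetric] iff
      using k(1) by (simp add: coprime_commute coprime_dvd_mult_right_iff)
    thus ?thesis using le1 o by simp
  qed
qed

lemma poly_qint_poly: "poly (qint_poly N) z = (\<Sum>i<N. z^i)"
  by (simp add: qint_poly_def poly_sum poly_monom)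

text \<open>\<open>(X - 1)\<close> times the polynomial is \<open>X^N - 1\<close>, which is
  squarefree because its derivative shares no root with it.\<close>

lemma order_qint_poly:
  assumes "N > 0"
  shows "qint_poly N \<noteq> 0" "order z (qint_poly N) \<le> 1"
    and "poly (qint_poly N) z = 0 \<Longrightarrow> z^N = 1 \<and> z \<noteq> 1"
proof -
  show nz: "qint_poly N \<noteq> 0"
  proof
    assume "qint_poly N = 0"
    with poly_qint_poly[of N 1] assms show False by simp
  qed
  show "z^N = 1 \<and> z \<noteq> 1" if "poly (qint_poly N) z = 0"
    using that geom[of z N] assms by (auto simp: poly_qint_poly)
  have "poly ([:-1, 1:] * qint_poly N) = poly (monom 1 N - 1)"
  proof
    fix x
    show "poly ([:-1, 1:] * qint_poly N) x = poly (monom 1 N - 1) x"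
      using geom[of x N] by (simp add: poly_qint_poly poly_monom algebra_simps)
  qed
  hence eq: "[:-1, 1:] * qint_poly N = monom 1 N - 1" by (simp only: poly_eq_poly_eq_iff)
  have "rsquarefree (monom 1 N - 1 :: complex poly)"
    unfolding rsquarefree_roots
    using assms by (auto simp: pderiv_diff pderiv_monom poly_monom power_0_left)
  hence "order z ([:-1, 1:] * qint_poly N) \<le> 1" unfolding eq rsquarefree_def by (metis le_numeral_extra(4) zero_le)
  moreover have "[:-1, 1:] * qint_poly N \<noteq> 0" using nz by (simp only: mult_eq_0_iff) simp
  ultimately show "order z (qint_poly N) \<le> 1" using order_mult[of "[:-1, 1:]" "qint_poly N" z] by linarith
qed

text \<open>A number has only one order, so at most one squared cyclotomic factor vanishes at
  \<open>z\<close>, with multiplicity two; the factor \<open>[n^r]\<close> adds at most one.\<close>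

lemma order_modulus:
  fixes n r :: nat and z :: complex
  assumes n: "n > 1"
  defines "P \<equiv> qint_poly (n^r) * (\<Prod>j\<in>{1..r}. cyclotomic (n^j) ^ 2)"
  shows "P \<noteq> 0"
    and "order z P \<le> 1 + (if \<exists>j\<in>{1..r}. primroot (n^j) z then 2 else 0)"
    and "poly P z = 0 \<Longrightarrow> z^(n^r) = 1 \<and> z \<noteq> 1"
proof -
  have npos: "n^j > 0" for j using n by simp
  have cnz: "cyclotomic (n^j) \<noteq> 0" for j using order_cyclotomic(1)[OF npos] .
  have pnz: "(\<Prod>j\<in>{1..r}. cyclotomic (n^j) ^ 2) \<noteq> 0" using cnz by simp
  show P0: "P \<noteq> 0" unfolding P_def using pnz order_qint_poly(1)[OF npos] by simp
  have "order z (\<Prod>j\<in>{1..r}. cyclotomic (n^j) ^ 2) = (\<Sum>j\<in>{1..r}. 2 * order z (cyclotomic (n^j)))"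
    using cnz by (subst order_prod) (auto simp: power2_eq_square order_mult mult_2)
  also have "\<dots> \<le> (\<Sum>j\<in>{1..r}. if primroot (n^j) z then 2 else 0)"
  proof (rule sum_mono)
    fix j
    show "2 * order z (cyclotomic (n^j)) \<le> (if primroot (n^j) z then 2 else 0)"
      using order_cyclotomic(2)[OF npos, of z j] by (simp split: if_splits)
  qed
  also have "\<dots> \<le> (if \<exists>j\<in>{1..r}. primroot (n^j) z then 2 else 0)"
  proof (cases "\<exists>j\<in>{1..r}. primroot (n^j) z")
    case True
    then obtain j0 where j0: "j0 \<in> {1..r}" "primroot (n^j0) z" by blast
    have "primroot (n^j) z \<longleftrightarrow> j = j0" for j
    proof
      assume "primroot (n^j) z"
      hence "n^j dvd i \<longleftrightarrow> n^j0 dvd i" for i using j0(2) unfolding primroot_def by metis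
      hence "n^j = n^j0" by (metis dvd_antisym dvd_refl)
      thus "j = j0" using n by simp
    qed (use j0 in simp)
    thus ?thesis using j0 by (simp add: sum.delta')
  qed auto
  finally have 1: "order z (\<Prod>j\<in>{1..r}. cyclotomic (n^j) ^ 2) \<le> (if \<exists>j\<in>{1..r}. primroot (n^j) z then 2 else 0)" .
  show "order z P \<le> 1 + (if \<exists>j\<in>{1..r}. primroot (n^j) z then 2 else 0)"
    using P0 1 order_qint_poly(2)[OF npos, of z r] unfolding P_def by (subst order_mult) (auto intro: add_mono)
  show "z^(n^r) = 1 \<and> z \<noteq> 1" if root: "poly P z = 0"
  proof (cases "poly (qint_poly (n^r)) z = 0")
    case True
    thus ?thesis using order_qint_poly(3)[OF npos] by blast
  next
    case False
    then obtain j where j: "j \<in> {1..r}" "poly (cyclotomic (n^j)) z = 0"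
      using root unfolding P_def by (auto simp: poly_prod)
    hence "order z (cyclotomic (n^j)) \<noteq> 0" using cnz by (simp add: order_root)
    hence "primroot (n^j) z" using order_cyclotomic(2)[OF npos, of z j] by (auto split: if_splits)
    hence iff: "z^i = 1 \<longleftrightarrow> n^j dvd i" for i by (simp add: primroot_def)
    have "n^j dvd n^r" using j by (intro le_imp_power_dvd) simp
    moreover have "\<not> n^j dvd 1" using n j by simp
    ultimately show ?thesis using iff[of "n^r"] iff[of 1] by simp
  qed
qed

text \<open>Both congruences at once, through the two alternatives in \<open>shape\<close>. At roots
  of order \<open>n^i\<close> order three is required. For composite \<open>n\<close> there can be
  further roots of \<open>[n^r]\<close>, whose orders divide \<open>n^r\<close> without being powers
  of \<open>n\<close>; there order one suffices.\<close>

lemma main_qcong: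
  fixes n r :: nat
  assumes "odd n" and n1: "n > 1" and r: "r \<ge> 1"
    and shape: "M1 + 1 = n^r \<and> M2 + 1 = n^(r-1) \<or> 2*M1+1 = n^r \<and> 2*M2+1 = n^(r-1)"
  shows "qcong (\<Sum>k\<le>M1. summand qX k)
               ((- qX) powi ((1 - int n) div 2) * qint qX n * (\<Sum>k\<le>M2. summand (qX ^ n) k))
               (qint_poly (n^r) * (\<Prod>j\<in>{1..r}. cyclotomic (n^j) ^ 2))"
proof (rule qcongI[OF order_modulus(1)[OF n1]])
  obtain h where n: "n = 2*h+1" using \<open>odd n\<close> by (auto elim: oddE)
  fix \<zeta> assume "poly (qint_poly (n^r) * (\<Prod>j\<in>{1..r}. cyclotomic (n^j) ^ 2)) \<zeta> = 0"
  hence z: "\<zeta>^(n^r) = 1" "\<zeta> \<noteq> 1" using order_modulus(3)[OF n1] by blast+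
  obtain m where m0: "m > 0" and pr: "primroot m \<zeta>" using primroot_exists[OF z(1)] n1 by auto
  have iff: "\<zeta>^i = 1 \<longleftrightarrow> m dvd i" for i using pr by (simp add: primroot_def)
  have md: "m dvd n^r" using z iff by blast
  have oddm: "odd m" using md \<open>odd n\<close> by (meson dvd_trans even_power)
  have m1: "m > 1" using z(2) iff[of 1] m0 by (cases "m = 1") auto
  have nr: "n^r = n * n^(r-1)" using r by (cases r) auto
  have zn: "(\<zeta>^n)^(n^(r-1)) = 1" using z(1) unfolding nr by (simp add: power_mult)
  obtain m' where m'0: "m' > 0" and prn: "primroot m' (\<zeta>^n)" using primroot_exists[OF zn] n1 by auto
  have "m' dvd n^(r-1)" using zn prn unfolding primroot_def by blast
  hence oddm': "odd m'" using \<open>odd n\<close> by (meson dvd_trans even_power)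
  have eq: "(\<Sum>k\<le>M1. summand qX k) - (- qX) powi ((1 - int n) div 2) * qint qX n * (\<Sum>k\<le>M2. summand (qX ^ n) k)
      = discrepancy n M1 M2 0"
    by (simp add: discrepancy_def summand_eq_psummand)
  have good0: "good m \<zeta> 0" "good m' (\<zeta>^n) 0"
    using pr prn by (auto simp: good_def qquad_def primroot_def)
  have v1: "vge \<zeta> 1 (discrepancy n M1 M2 0)"
    using discrepancy_vge_1[OF n r shape pr m1 md prn good0] by simp
  have v3: "vge \<zeta> 3 (discrepancy n M1 M2 0)" if i: "i \<in> {1..r}" "primroot (n^i) \<zeta>" for i
  proof (rule discrepancy_vge_3[OF n pr oddm prn oddm'])
    have m: "m = n^i" using i(2) pr unfolding primroot_def by (metis dvd_antisym dvd_refl)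
    show "M2 * n + h \<le> M1" using shape
    proof
      assume a: "M1 + 1 = n^r \<and> M2 + 1 = n^(r-1)"
      hence "M1 + 1 = n * (M2 + 1)" using nr by simp
      thus ?thesis using n by (simp add: algebra_simps)
    next
      assume a: "2*M1+1 = n^r \<and> 2*M2+1 = n^(r-1)"
      hence "2*M1 + 1 = n * (2*M2 + 1)" using nr by simp
      thus ?thesis using n by (simp add: algebra_simps)
    qed
    show "(\<Sum>j\<le>M2. of_bool (m dvd (2*j+1)*n)) \<ge> (\<Sum>j<M1. of_bool (m dvd j+1)) + (1::int)"
      unfolding m using i by (intro count_le[OF n _ _ shape]) auto
    fix y assume y: "generic \<zeta> y"
    have "good m \<zeta> y" using generic_good[OF y, of m 1] by simp
    thus "vge \<zeta> 1 (discrepancy n M1 M2 (qconst y))"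
      by (rule discrepancy_vge_1[OF n r shape pr m1 md prn _ generic_good[OF y]])
  qed
  show "vge \<zeta> (int (order \<zeta> (qint_poly (n^r) * (\<Prod>j\<in>{1..r}. cyclotomic (n^j) ^ 2))))
     ((\<Sum>k\<le>M1. summand qX k) - (- qX) powi ((1 - int n) div 2) * qint qX n * (\<Sum>k\<le>M2. summand (qX ^ n) k))"
    unfolding eq
  proof (cases "\<exists>j\<in>{1..r}. primroot (n^j) \<zeta>")
    case True
    hence "vge \<zeta> 3 (discrepancy n M1 M2 0)" using v3 by blast
    thus "vge \<zeta> (int (order \<zeta> (qint_poly (n^r) * (\<Prod>j\<in>{1..r}. cyclotomic (n^j) ^ 2)))) (discrepancy n M1 M2 0)"
      by (rule vge_mono) (use order_modulus(2)[OF n1, where z = \<zeta> and r = r] True in simp)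
  next
    case False
    show "vge \<zeta> (int (order \<zeta> (qint_poly (n^r) * (\<Prod>j\<in>{1..r}. cyclotomic (n^j) ^ 2)))) (discrepancy n M1 M2 0)"
      by (rule vge_mono[OF v1]) (use order_modulus(2)[OF n1, where z = \<zeta> and r = r] False in \<open>simp split: if_splits\<close>)
  qed
qed

theorem theorem1p2:
  fixes n r :: nat
  assumes "odd n" and "n > 1" and "r \<ge> 1"
  shows "qcong (\<Sum>k\<le>(n^r - 1) div 2. summand qX k)
               ((- qX) powi ((1 - int n) div 2) * qint qX n *
                  (\<Sum>k\<le>(n^(r-1) - 1) div 2. summand (qX ^ n) k))
               (qint_poly (n^r) * (\<Prod>j\<in>{1..r}. cyclotomic (n^j) ^ 2))
       \<and> qcong (\<Sum>k\<le>n^r - 1. summand qX k)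
               ((- qX) powi ((1 - int n) div 2) * qint qX n *
                  (\<Sum>k\<le>n^(r-1) - 1. summand (qX ^ n) k))
               (qint_poly (n^r) * (\<Prod>j\<in>{1..r}. cyclotomic (n^j) ^ 2))"
proof
  have odd: "odd (n^j)" and pos: "n^j > 0" for j using assms by auto
  \<comment> \<open>The halving is exact since \<open>n^j\<close> is odd; this puts the half-length
    ranges into the second alternative of \<open>shape\<close>.\<close>
  have "2 * ((n^j - 1) div 2) + 1 = n^j" for j using odd[of j] by (auto elim!: oddE)
  thus "qcong (\<Sum>k\<le>(n^r - 1) div 2. summand qX k)
               ((- qX) powi ((1 - int n) div 2) * qint qX n *
                  (\<Sum>k\<le>(n^(r-1) - 1) div 2. summand (qX ^ n) k))
               (qint_poly (n^r) * (\<Prod>j\<in>{1..r}. cyclotomic (n^j) ^ 2))"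
    by (intro main_qcong[OF assms]) blast
  show "qcong (\<Sum>k\<le>n^r - 1. summand qX k)
               ((- qX) powi ((1 - int n) div 2) * qint qX n *
                  (\<Sum>k\<le>n^(r-1) - 1. summand (qX ^ n) k))
               (qint_poly (n^r) * (\<Prod>j\<in>{1..r}. cyclotomic (n^j) ^ 2))"
    using pos[of r] pos[of "r-1"] by (intro main_qcong[OF assms]) auto
qed

end
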